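(* Let $\mathcal{T}$ be a triangulated category, and let $u\colon X\to Y$, $u'\colon X'\to Y'$, $f\colon X\to X'$, $g\colon Y\to Y'$ be maps in $\mathcal{T}$ with $gu=u'f$. Choose exact triangles $X\xrightarrow{u}Y\xrightarrow{v}Z\xrightarrow{w}\Sigma X$ and $X'\xrightarrow{u'}Y'\xrightarrow{v'}Z'\xrightarrow{w'}\Sigma X'$. The following are equivalent. (1) There exists a lift, i.e. a map $k\colon Y\to X'$ with $ku=f$ and $u'k=g$. (2) The map $0\colon Z\to Z'$ is a fill-in (i.e. $(f,g,0)$ is a map of triangles from $(u,v,w)$ to $(u',v',w')$), and the map of triangles $(f,g,0)$ is good. (3) The map $0\colon Z\to Z'$ is a fill-in, and the map $(0,f,g)$ of rotated triangles, from $\Sigma^{-1}Z\xrightarrow{-\Sigma^{-1}w}X\xrightarrow{u}Y\xrightarrow{v}Z$ to $\Sigma^{-1}Z'\xrightarrow{-\Sigma^{-1}w'}X'\xrightarrow{u'}Y'\xrightarrow{v'}Z'$, is Verdier good.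
   Context: $\mathcal{T}$ is a triangulated category with self-equivalence $\Sigma$; the natural isomorphisms $\Sigma\Sigma^{-1}\cong 1\cong\Sigma^{-1}\Sigma$ are suppressed. "Exact triangle" or "triangle" means distinguished triangle. A map of triangles $(f,g,h)$ from $X\xrightarrow{u}Y\xrightarrow{v}Z\xrightarrow{w}\Sigma X$ to $X'\xrightarrow{u'}Y'\xrightarrow{v'}Z'\xrightarrow{w'}\Sigma X'$ consists of $f\colon X\to X'$, $g\colon Y\to Y'$, $h\colon Z\to Z'$ with $gu=u'f$, $hv=v'g$, $(\Sigma f)w=w'h$. Given $f,g$ with $gu=u'f$, a fill-in is an $h$ making $(f,g,h)$ a map of triangles. The mapping cone of $(f,g,h)$ is the sequence $X'\oplus Y\to Y'\oplus Z\to Z'\oplus\Sigma X\to\Sigma X'\oplus\Sigma Y$ with successive maps $\begin{bmatrix}u'&g\\0&-v\end{bmatrix},\begin{bmatrix}v'&h\\0&-w\end{bmatrix},\begin{bmatrix}w'&\Sigma f\\0&-\Sigma u\end{bmatrix}$ (acting on column vectors). $(f,g,h)$ is good if its mapping cone is an exact triangle. Octahedra: given composable maps $P\xrightarrow{a}Q\xrightarrow{b}R$ and exact triangles $P\xrightarrow{a}Q\xrightarrow{a'}C_a\xrightarrow{a''}\Sigma P$, $Q\xrightarrow{b}R\xrightarrow{b'}C_b\xrightarrow{b''}\Sigma Q$, $P\xrightarrow{ba}R\xrightarrow{c'}C\xrightarrow{c''}\Sigma P$, an octahedron for the composite $ba$ consists of maps $\alpha\colon C_a\to C$, $\beta\colon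 C\to C_b$, $\gamma\colon C_b\to\Sigma C_a$ such that $C_a\xrightarrow{\alpha}C\xrightarrow{\beta}C_b\xrightarrow{\gamma}\Sigma C_a$ is exact and $\alpha a'=c'b$, $c''\alpha=a''$, $\beta c'=b'$, $\gamma=(\Sigma a')b''$, $b''\beta=(\Sigma a)c''$. Verdier good: choose exact triangles $X\xrightarrow{f}X'\xrightarrow{f'}X''\xrightarrow{f''}\Sigma X$, $Y\xrightarrow{g}Y'\xrightarrow{g'}Y''\xrightarrow{g''}\Sigma Y$ and $X\xrightarrow{gu=u'f}Y'\xrightarrow{\tilde v}A\xrightarrow{\tilde w}\Sigma X$. The map $(f,g,h)$ is Verdier good if there exist an octahedron $(\alpha_1\colon Z\to A,\ \beta_1\colon A\to Y'',\ \gamma_1)$ for the composite $X\xrightarrow{u}Y\xrightarrow{g}Y'$ and an octahedron $(\alpha_2\colon X''\to A,\ \beta_2\colon A\to Z',\ \gamma_2)$ for the composite $X\xrightarrow{f}X'\xrightarrow{u'}Y'$ (both using the given and chosen triangles, in particular the same triangle on $gu=u'f$) such that $h=\beta_2\alpha_1$. This does not depend on the chosen triangles. *)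

theory Defs
  imports "HOL-Algebra.Group"
begin

section \<open>Additive categories\<close>

text \<open>
  A category has a set of objects and a set of arrows; every arrow knows its source and target,
  so hom-sets between different pairs of objects are disjoint. As usual for carrier-based
  structures, nothing is assumed about the operations outside of these sets.
  Composition is written in the usual order: first \<open>f\<close>, then \<open>g\<close> is \<open>g \<cdot> f\<close>.
\<close>

record ('o, 'm) cat =
  obj :: "'o set"
  arr :: "'m set"
  src :: "'m \<Rightarrow> 'o"
  tgt :: "'m \<Rightarrow> 'o"
  ident :: "'o \<Rightarrow> 'm"
  cmp :: "'m \<Rightarrow> 'm \<Rightarrow> 'm"  (infixr "\<cdot>\<index>" 70)

definition Hom :: "('o, 'm, 'e) cat_scheme \<Rightarrow> 'o \<Rightarrow> 'o \<Rightarrow> 'm set" where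
  "Hom C X Y = {f \<in> arr C. src C f = X \<and> tgt C f = Y}"

locale category =
  fixes C :: "('o, 'm, 'e) cat_scheme" (structure)
  assumes src_in_obj: "f \<in> arr C \<Longrightarrow> src C f \<in> obj C"
    and tgt_in_obj: "f \<in> arr C \<Longrightarrow> tgt C f \<in> obj C"
    and ident_in_Hom: "X \<in> obj C \<Longrightarrow> ident C X \<in> Hom C X X"
    and cmp_in_Hom: "\<lbrakk>f \<in> Hom C X Y; g \<in> Hom C Y Z\<rbrakk> \<Longrightarrow> g \<cdot> f \<in> Hom C X Z"
    and cmp_ident_right: "f \<in> Hom C X Y \<Longrightarrow> f \<cdot> ident C X = f"
    and cmp_ident_left: "f \<in> Hom C X Y \<Longrightarrow> ident C Y \<cdot> f = f"
    and cmp_assoc: "\<lbrakk>f \<in> Hom C W X; g \<in> Hom C X Y; h \<in> Hom C Y Z\<rbrakk>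
      \<Longrightarrow> h \<cdot> (g \<cdot> f) = (h \<cdot> g) \<cdot> f"

definition is_iso :: "('o, 'm, 'e) cat_scheme \<Rightarrow> 'm \<Rightarrow> bool" where
  "is_iso C f \<longleftrightarrow> f \<in> arr C \<and>
    (\<exists>g \<in> Hom C (tgt C f) (src C f).
      g \<cdot>\<^bsub>C\<^esub> f = ident C (src C f) \<and> f \<cdot>\<^bsub>C\<^esub> g = ident C (tgt C f))"

definition is_zero_obj :: "('o, 'm, 'e) cat_scheme \<Rightarrow> 'o \<Rightarrow> bool" where
  "is_zero_obj C N \<longleftrightarrow> N \<in> obj C \<and>
    (\<forall>X \<in> obj C. (\<exists>!f. f \<in> Hom C X N) \<and> (\<exists>!f. f \<in> Hom C N X))"

text \<open>
  \<open>dsum C X Y\<close> with \<open>in1\<close>, \<open>in2\<close>, \<open>pr1\<close>, \<open>pr2\<close> is a choice of direct sum of \<open>X\<close> and \<open>Y\<close>.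
\<close>

record ('o, 'm) additive_cat = "('o, 'm) cat" +
  zero_arr :: "'o \<Rightarrow> 'o \<Rightarrow> 'm"
  add_arr :: "'m \<Rightarrow> 'm \<Rightarrow> 'm"  (infixl "\<oplus>\<index>" 65)
  dsum :: "'o \<Rightarrow> 'o \<Rightarrow> 'o"
  in1 :: "'o \<Rightarrow> 'o \<Rightarrow> 'm"
  in2 :: "'o \<Rightarrow> 'o \<Rightarrow> 'm"
  pr1 :: "'o \<Rightarrow> 'o \<Rightarrow> 'm"
  pr2 :: "'o \<Rightarrow> 'o \<Rightarrow> 'm"

definition Hom_group :: "('o, 'm, 'e) additive_cat_scheme \<Rightarrow> 'o \<Rightarrow> 'o \<Rightarrow> 'm monoid" where
  "Hom_group C X Y =
    \<lparr>carrier = Hom C X Y, monoid.mult = add_arr C, monoid.one = zero_arr C X Y\<rparr>"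

definition neg :: "('o, 'm, 'e) additive_cat_scheme \<Rightarrow> 'm \<Rightarrow> 'm" where
  "neg C f = inv\<^bsub>Hom_group C (src C f) (tgt C f)\<^esub> f"

locale additive_category = category C
  for C :: "('o, 'm, 'e) additive_cat_scheme" (structure) +
  assumes Hom_comm_group: "\<lbrakk>X \<in> obj C; Y \<in> obj C\<rbrakk> \<Longrightarrow> comm_group (Hom_group C X Y)"
    and cmp_add_right: "\<lbrakk>f \<in> Hom C X Y; f' \<in> Hom C X Y; g \<in> Hom C Y Z\<rbrakk>
      \<Longrightarrow> g \<cdot> (f \<oplus> f') = g \<cdot> f \<oplus> g \<cdot> f'"
    and cmp_add_left: "\<lbrakk>f \<in> Hom C X Y; g \<in> Hom C Y Z; g' \<in> Hom C Y Z\<rbrakk>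
      \<Longrightarrow> (g \<oplus> g') \<cdot> f = g \<cdot> f \<oplus> g' \<cdot> f"
    and zero_obj_exists: "\<exists>N. is_zero_obj C N"
    and dsum_in_obj: "\<lbrakk>X \<in> obj C; Y \<in> obj C\<rbrakk> \<Longrightarrow> dsum C X Y \<in> obj C"
    and in1_in_Hom: "\<lbrakk>X \<in> obj C; Y \<in> obj C\<rbrakk> \<Longrightarrow> in1 C X Y \<in> Hom C X (dsum C X Y)"
    and in2_in_Hom: "\<lbrakk>X \<in> obj C; Y \<in> obj C\<rbrakk> \<Longrightarrow> in2 C X Y \<in> Hom C Y (dsum C X Y)"
    and pr1_in_Hom: "\<lbrakk>X \<in> obj C; Y \<in> obj C\<rbrakk> \<Longrightarrow> pr1 C X Y \<in> Hom C (dsum C X Y) X"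
    and pr2_in_Hom: "\<lbrakk>X \<in> obj C; Y \<in> obj C\<rbrakk> \<Longrightarrow> pr2 C X Y \<in> Hom C (dsum C X Y) Y"
    and pr1_in1: "\<lbrakk>X \<in> obj C; Y \<in> obj C\<rbrakk> \<Longrightarrow> pr1 C X Y \<cdot> in1 C X Y = ident C X"
    and pr2_in2: "\<lbrakk>X \<in> obj C; Y \<in> obj C\<rbrakk> \<Longrightarrow> pr2 C X Y \<cdot> in2 C X Y = ident C Y"
    and pr1_in2: "\<lbrakk>X \<in> obj C; Y \<in> obj C\<rbrakk> \<Longrightarrow> pr1 C X Y \<cdot> in2 C X Y = zero_arr C Y X"
    and pr2_in1: "\<lbrakk>X \<in> obj C; Y \<in> obj C\<rbrakk> \<Longrightarrow> pr2 C X Y \<cdot> in1 C X Y = zero_arr C X Y"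
    and in_pr_sum: "\<lbrakk>X \<in> obj C; Y \<in> obj C\<rbrakk>
      \<Longrightarrow> in1 C X Y \<cdot> pr1 C X Y \<oplus> in2 C X Y \<cdot> pr2 C X Y = ident C (dsum C X Y)"

text \<open>
  The map \<open>A \<oplus> B \<rightarrow> A' \<oplus> B'\<close> given by the matrix with rows \<open>p, q\<close> and \<open>r, s\<close> acting on
  column vectors, where \<open>p : A \<rightarrow> A'\<close>, \<open>q : B \<rightarrow> A'\<close>, \<open>r : A \<rightarrow> B'\<close>, \<open>s : B \<rightarrow> B'\<close>.
\<close>

definition matrix_map ::
    "('o, 'm, 'e) additive_cat_scheme \<Rightarrow> 'm \<Rightarrow> 'm \<Rightarrow> 'm \<Rightarrow> 'm \<Rightarrow> 'm" where
  "matrix_map C p q r s =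
    (let A = src C p; B = src C q; A' = tgt C p; B' = tgt C r in
      (in1 C A' B' \<cdot>\<^bsub>C\<^esub> p \<cdot>\<^bsub>C\<^esub> pr1 C A B \<oplus>\<^bsub>C\<^esub> in1 C A' B' \<cdot>\<^bsub>C\<^esub> q \<cdot>\<^bsub>C\<^esub> pr2 C A B)
      \<oplus>\<^bsub>C\<^esub> (in2 C A' B' \<cdot>\<^bsub>C\<^esub> r \<cdot>\<^bsub>C\<^esub> pr1 C A B \<oplus>\<^bsub>C\<^esub> in2 C A' B' \<cdot>\<^bsub>C\<^esub> s \<cdot>\<^bsub>C\<^esub> pr2 C A B))"

definition endofunctor ::
    "('o, 'm, 'e) cat_scheme \<Rightarrow> ('o \<Rightarrow> 'o) \<Rightarrow> ('m \<Rightarrow> 'm) \<Rightarrow> bool" where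
  "endofunctor C Fo Fm \<longleftrightarrow>
    (\<forall>X \<in> obj C. Fo X \<in> obj C \<and> Fm (ident C X) = ident C (Fo X)) \<and>
    (\<forall>X Y. \<forall>f \<in> Hom C X Y. Fm f \<in> Hom C (Fo X) (Fo Y)) \<and>
    (\<forall>X Y Z. \<forall>f \<in> Hom C X Y. \<forall>g \<in> Hom C Y Z. Fm (g \<cdot>\<^bsub>C\<^esub> f) = Fm g \<cdot>\<^bsub>C\<^esub> Fm f)"

definition natural_iso ::
    "('o, 'm, 'e) cat_scheme \<Rightarrow> ('o \<Rightarrow> 'o) \<Rightarrow> ('m \<Rightarrow> 'm) \<Rightarrow> ('o \<Rightarrow> 'o) \<Rightarrow> ('m \<Rightarrow> 'm)
      \<Rightarrow> ('o \<Rightarrow> 'm) \<Rightarrow> bool" where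
  "natural_iso C Fo Fm Go Gm \<theta> \<longleftrightarrow>
    (\<forall>X \<in> obj C. \<theta> X \<in> Hom C (Fo X) (Go X) \<and> is_iso C (\<theta> X)) \<and>
    (\<forall>X Y. \<forall>f \<in> Hom C X Y. \<theta> Y \<cdot>\<^bsub>C\<^esub> Fm f = Gm f \<cdot>\<^bsub>C\<^esub> \<theta> X)"


section \<open>Triangulated categories\<close>

text \<open>
  The suspension \<open>\<Sigma>\<close> (\<open>susp_obj\<close>, \<open>susp\<close>) is a self-equivalence, not necessarily an automorphism.
  Its quasi-inverse \<open>\<Sigma>\<inverse>\<close> (\<open>desusp_obj\<close>, \<open>desusp\<close>) comes with the natural isomorphisms
  \<open>unit X : X \<rightarrow> \<Sigma>\<Sigma>\<inverse>X\<close> and \<open>counit X : \<Sigma>\<inverse>\<Sigma>X \<rightarrow> X\<close>, which are usually suppressed; they are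
  assumed to satisfy the triangle identities, since suppressing them is only meaningful for
  an adjoint equivalence (and every equivalence can be completed to one).
  A triangle \<open>X \<rightarrow> Y \<rightarrow> Z \<rightarrow> \<Sigma>X\<close> is the triple of its maps, and \<open>exact\<close> is the class of
  distinguished triangles.
\<close>

type_synonym 'm triangle = "'m \<times> 'm \<times> 'm"

record ('o, 'm) triangulated_cat = "('o, 'm) additive_cat" +
  susp_obj :: "'o \<Rightarrow> 'o"
  susp :: "'m \<Rightarrow> 'm"
  desusp_obj :: "'o \<Rightarrow> 'o"
  desusp :: "'m \<Rightarrow> 'm"
  unit :: "'o \<Rightarrow> 'm"
  counit :: "'o \<Rightarrow> 'm"
  exact :: "'m triangle set"

definition candidate_triangle ::
    "('o, 'm, 'e) triangulated_cat_scheme \<Rightarrow> 'm triangle \<Rightarrow> bool" where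
  "candidate_triangle C = (\<lambda>(u, v, w). \<exists>X Y Z.
    u \<in> Hom C X Y \<and> v \<in> Hom C Y Z \<and> w \<in> Hom C Z (susp_obj C X))"

definition commuting_triple ::
    "('o, 'm, 'e) triangulated_cat_scheme \<Rightarrow> 'm triangle \<Rightarrow> 'm triangle
      \<Rightarrow> 'm \<Rightarrow> 'm \<Rightarrow> 'm \<Rightarrow> bool" where
  "commuting_triple C = (\<lambda>(u, v, w) (u', v', w') f g h.
    f \<in> Hom C (src C u) (src C u') \<and>
    g \<in> Hom C (src C v) (src C v') \<and>
    h \<in> Hom C (src C w) (src C w') \<and>
    g \<cdot>\<^bsub>C\<^esub> u = u' \<cdot>\<^bsub>C\<^esub> f \<and>
    h \<cdot>\<^bsub>C\<^esub> v = v' \<cdot>\<^bsub>C\<^esub> g \<and>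
    susp C f \<cdot>\<^bsub>C\<^esub> w = w' \<cdot>\<^bsub>C\<^esub> h)"

definition triangle_map ::
    "('o, 'm, 'e) triangulated_cat_scheme \<Rightarrow> 'm triangle \<Rightarrow> 'm triangle
      \<Rightarrow> 'm \<Rightarrow> 'm \<Rightarrow> 'm \<Rightarrow> bool" where
  "triangle_map C T T' f g h \<longleftrightarrow>
    T \<in> exact C \<and> T' \<in> exact C \<and> commuting_triple C T T' f g h"

definition fill_in ::
    "('o, 'm, 'e) triangulated_cat_scheme \<Rightarrow> 'm triangle \<Rightarrow> 'm triangle
      \<Rightarrow> 'm \<Rightarrow> 'm \<Rightarrow> 'm \<Rightarrow> bool" where
  "fill_in C T T' f g h \<longleftrightarrow> triangle_map C T T' f g h"

text \<open>
  \<open>octahedron C (a, a', a'') (b, b', b'') (c, c', c'') \<alpha> \<beta> \<gamma>\<close>: the maps \<open>\<alpha>, \<beta>, \<gamma>\<close> form an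
  octahedron for the composite \<open>c = b \<cdot> a\<close> relative to the three given exact triangles.
\<close>

definition octahedron ::
    "('o, 'm, 'e) triangulated_cat_scheme \<Rightarrow> 'm triangle \<Rightarrow> 'm triangle \<Rightarrow> 'm triangle
      \<Rightarrow> 'm \<Rightarrow> 'm \<Rightarrow> 'm \<Rightarrow> bool" where
  "octahedron C = (\<lambda>(a, a', a'') (b, b', b'') (c, c', c'') \<alpha> \<beta> \<gamma>.
    (a, a', a'') \<in> exact C \<and> (b, b', b'') \<in> exact C \<and> (c, c', c'') \<in> exact C \<and>
    tgt C a = src C b \<and> c = b \<cdot>\<^bsub>C\<^esub> a \<and>
    \<alpha> \<in> Hom C (tgt C a') (tgt C c') \<and>
    \<beta> \<in> Hom C (tgt C c') (tgt C b') \<and>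
    \<gamma> \<in> Hom C (tgt C b') (susp_obj C (tgt C a')) \<and>
    (\<alpha>, \<beta>, \<gamma>) \<in> exact C \<and>
    \<alpha> \<cdot>\<^bsub>C\<^esub> a' = c' \<cdot>\<^bsub>C\<^esub> b \<and>
    c'' \<cdot>\<^bsub>C\<^esub> \<alpha> = a'' \<and>
    \<beta> \<cdot>\<^bsub>C\<^esub> c' = b' \<and>
    \<gamma> = susp C a' \<cdot>\<^bsub>C\<^esub> b'' \<and>
    b'' \<cdot>\<^bsub>C\<^esub> \<beta> = susp C a \<cdot>\<^bsub>C\<^esub> c'')"

locale triangulated_category = additive_category C
  for C :: "('o, 'm, 'e) triangulated_cat_scheme" (structure) +
  assumes susp_functor: "endofunctor C (susp_obj C) (susp C)"
    and susp_additive: "\<lbrakk>f \<in> Hom C X Y; g \<in> Hom C X Y\<rbrakk>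
      \<Longrightarrow> susp C (f \<oplus> g) = susp C f \<oplus> susp C g"
    and desusp_functor: "endofunctor C (desusp_obj C) (desusp C)"
    and unit_iso: "natural_iso C (\<lambda>X. X) (\<lambda>f. f)
      (susp_obj C \<circ> desusp_obj C) (susp C \<circ> desusp C) (unit C)"
    and counit_iso: "natural_iso C (desusp_obj C \<circ> susp_obj C) (desusp C \<circ> susp C)
      (\<lambda>X. X) (\<lambda>f. f) (counit C)"
    and triangle_identity_susp: "X \<in> obj C
      \<Longrightarrow> susp C (counit C X) \<cdot> unit C (susp_obj C X) = ident C (susp_obj C X)"
    and triangle_identity_desusp: "X \<in> obj C
      \<Longrightarrow> counit C (desusp_obj C X) \<cdot> desusp C (unit C X) = ident C (desusp_obj C X)"
    and exact_candidate: "T \<in> exact C \<Longrightarrow> candidate_triangle C T"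
    and exact_iso_closed: "\<lbrakk>T \<in> exact C; candidate_triangle C T'; commuting_triple C T T' f g h;
      is_iso C f; is_iso C g; is_iso C h\<rbrakk> \<Longrightarrow> T' \<in> exact C"
    and exact_ident: "\<lbrakk>X \<in> obj C; is_zero_obj C N\<rbrakk>
      \<Longrightarrow> (ident C X, zero_arr C X N, zero_arr C N (susp_obj C X)) \<in> exact C"
    and exact_extend: "u \<in> arr C \<Longrightarrow> \<exists>v w. (u, v, w) \<in> exact C"
    and exact_rotate: "candidate_triangle C (u, v, w)
      \<Longrightarrow> (u, v, w) \<in> exact C \<longleftrightarrow> (v, w, neg C (susp C u)) \<in> exact C"
    and fill_in_exists: "\<lbrakk>(u, v, w) \<in> exact C; (u', v', w') \<in> exact C;
      f \<in> Hom C (src C u) (src C u'); g \<in> Hom C (src C v) (src C v'); g \<cdot> u = u' \<cdot> f\<rbrakk>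
      \<Longrightarrow> \<exists>h. fill_in C (u, v, w) (u', v', w') f g h"
    and octahedral: "\<lbrakk>(a, a', a'') \<in> exact C; (b, b', b'') \<in> exact C; tgt C a = src C b;
      (b \<cdot> a, c', c'') \<in> exact C\<rbrakk>
      \<Longrightarrow> \<exists>\<alpha> \<beta> \<gamma>. octahedron C (a, a', a'') (b, b', b'') (b \<cdot> a, c', c'') \<alpha> \<beta> \<gamma>"

text \<open>
  The rotated triangle \<open>\<Sigma>\<inverse>Z \<rightarrow> X \<rightarrow> Y \<rightarrow> Z\<close> with maps \<open>-\<Sigma>\<inverse>w\<close>, \<open>u\<close>, \<open>v\<close>. With the
  structure isomorphisms spelled out, its first map is \<open>-(\<Sigma>\<inverse>Z \<rightarrow> \<Sigma>\<inverse>\<Sigma>X \<rightarrow> X)\<close> and its last map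
  is \<open>Y \<rightarrow> Z \<rightarrow> \<Sigma>\<Sigma>\<inverse>Z\<close>.
\<close>

definition rotate_back ::
    "('o, 'm, 'e) triangulated_cat_scheme \<Rightarrow> 'm triangle \<Rightarrow> 'm triangle" where
  "rotate_back C = (\<lambda>(u, v, w).
    (neg C (counit C (src C u) \<cdot>\<^bsub>C\<^esub> desusp C w), u, unit C (tgt C v) \<cdot>\<^bsub>C\<^esub> v))"


section \<open>Good and Verdier good maps of triangles\<close>

text \<open>The canonical isomorphism \<open>\<Sigma>X \<oplus> \<Sigma>Y \<rightarrow> \<Sigma>(X \<oplus> Y)\<close>.\<close>

definition susp_dsum :: "('o, 'm, 'e) triangulated_cat_scheme \<Rightarrow> 'o \<Rightarrow> 'o \<Rightarrow> 'm" where
  "susp_dsum C X Y =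
    susp C (in1 C X Y) \<cdot>\<^bsub>C\<^esub> pr1 C (susp_obj C X) (susp_obj C Y) \<oplus>\<^bsub>C\<^esub>
    susp C (in2 C X Y) \<cdot>\<^bsub>C\<^esub> pr2 C (susp_obj C X) (susp_obj C Y)"

text \<open>
  The mapping cone. The last matrix maps to \<open>\<Sigma>X' \<oplus> \<Sigma>Y\<close>, which is identified with
  \<open>\<Sigma>(X' \<oplus> Y)\<close>, the suspension of the first object, by \<open>susp_dsum\<close>.
\<close>

definition mapping_cone ::
    "('o, 'm, 'e) triangulated_cat_scheme \<Rightarrow> 'm triangle \<Rightarrow> 'm triangle
      \<Rightarrow> 'm \<Rightarrow> 'm \<Rightarrow> 'm \<Rightarrow> 'm triangle" where
  "mapping_cone C = (\<lambda>(u, v, w) (u', v', w') f g h.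
    (let X = src C u; Y = src C v; Z = src C w;
         X' = src C u'; Y' = src C v'; Z' = src C w' in
      (matrix_map C
         u'                 g
         (zero_arr C X' Z)  (neg C v),
       matrix_map C
         v'                              h
         (zero_arr C Y' (susp_obj C X))  (neg C w),
       susp_dsum C X' Y \<cdot>\<^bsub>C\<^esub> matrix_map C
         w'                              (susp C f)
         (zero_arr C Z' (susp_obj C Y))  (neg C (susp C u)))))"

definition good ::
    "('o, 'm, 'e) triangulated_cat_scheme \<Rightarrow> 'm triangle \<Rightarrow> 'm triangle
      \<Rightarrow> 'm \<Rightarrow> 'm \<Rightarrow> 'm \<Rightarrow> bool" where
  "good C T T' f g h \<longleftrightarrow> triangle_map C T T' f g h \<and> mapping_cone C T T' f g h \<in> exact C"

text \<open>
  The existence of octahedra with \<open>h = \<beta>\<^sub>2 \<cdot> \<alpha>\<^sub>1\<close> is independent of the exact triangles chosen on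
  \<open>f\<close>, \<open>g\<close> and \<open>g \<cdot> u = u' \<cdot> f\<close>; the definition asks for it for some choice. Both octahedra use
  the same triangle \<open>(g \<cdot> u, p, q)\<close>.
\<close>

definition verdier_good ::
    "('o, 'm, 'e) triangulated_cat_scheme \<Rightarrow> 'm triangle \<Rightarrow> 'm triangle
      \<Rightarrow> 'm \<Rightarrow> 'm \<Rightarrow> 'm \<Rightarrow> bool" where
  "verdier_good C = (\<lambda>(u, v, w) (u', v', w') f g h.
    triangle_map C (u, v, w) (u', v', w') f g h \<and>
    (\<exists>f' f'' g' g'' p q.
      (f, f', f'') \<in> exact C \<and> (g, g', g'') \<in> exact C \<and> (g \<cdot>\<^bsub>C\<^esub> u, p, q) \<in> exact C \<and>
      (\<exists>\<alpha>\<^sub>1 \<beta>\<^sub>1 \<gamma>\<^sub>1 \<alpha>\<^sub>2 \<beta>\<^sub>2 \<gamma>\<^sub>2.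
        octahedron C (u, v, w) (g, g', g'') (g \<cdot>\<^bsub>C\<^esub> u, p, q) \<alpha>\<^sub>1 \<beta>\<^sub>1 \<gamma>\<^sub>1 \<and>
        octahedron C (f, f', f'') (u', v', w') (g \<cdot>\<^bsub>C\<^esub> u, p, q) \<alpha>\<^sub>2 \<beta>\<^sub>2 \<gamma>\<^sub>2 \<and>
        h = \<beta>\<^sub>2 \<cdot>\<^bsub>C\<^esub> \<alpha>\<^sub>1)))"

end

(*
  A lift k is a null-homotopy of (f, g, 0): the unipotent matrix with off-diagonal entry -k is an
  isomorphism from the cone of the zero map, a direct sum of two exact triangles, to the cone of
  (f, g, 0). Conversely both cones have the same middle map, so a fill-in compares them by a map
  with top row (x, y) satisfying u' x = u', u' y = g and x f = y u. Here x - 1 squares to zero,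
  and x^-1 y is a lift.

  For the rotated triangles the composite f a (a : desusp Z -> X) vanishes, so X' -> A splits.
  In the second octahedron beta_2 : A -> Y' factors as u' r for some retraction r of X' -> A,
  hence r alpha_1 is a lift. Conversely, given a lift k, take arbitrary octahedra; k and r alpha_1
  agree after composition with u, and moving A in the first octahedron by a unipotent automorphism
  absorbs their difference.
*)

theory Submission
  imports Defs
begin

section \<open>Calculus in additive categories\<close>

text \<open>Fill-ins are neither unique nor given as isomorphisms, and everything is derived from
  the axioms without long exact sequences or a five lemma. The substitute is a square-zero argument:
  a suitable error term n factors through some map of a triangle, and composing that map with n
  gives zero. Hence n n = 0, and 1 + n has the inverse 1 - n. This shows that a direct sum of exact
  triangles is exact, and it supplies the inverse of x in the overview: n = x - 1 satisfies u' n = 0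
  and (\<Sigma> n) w' = 0, the second equation makes \<Sigma> n factor through \<Sigma> u', and the
  first then kills the square. The comparison of the two cones itself is never inverted, only its
  corner x.

  The other obstacle is that \<Sigma> is merely an equivalence. Fill-ins of rotated triangles live
  between suspended objects, so fullness and faithfulness of \<Sigma> are needed to bring them back.
  The triangle identities enter through fullness and through the exactness of the backward
  rotation.\<close>

lemma HomI: "\<lbrakk>f \<in> arr C; src C f = X; tgt C f = Y\<rbrakk> \<Longrightarrow> f \<in> Hom C X Y"
  by (simp add: Hom_def)

lemma HomD: "f \<in> Hom C X Y \<Longrightarrow> f \<in> arr C \<and> src C f = X \<and> tgt C f = Y"
  by (simp add: Hom_def)

lemma arr_in_Hom: "f \<in> arr C \<Longrightarrow> f \<in> Hom C (src C f) (tgt C f)"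
  by (simp add: Hom_def)

lemma (in category) Hom_obj: "f \<in> Hom C X Y \<Longrightarrow> X \<in> obj C \<and> Y \<in> obj C"
  using src_in_obj tgt_in_obj by (auto simp: Hom_def)

section \<open>Arrows, composition and isomorphisms\<close>

context category
begin

text \<open>Typing is organised around \<open>arr\<close>, \<open>src\<close> and \<open>tgt\<close>
  instead of \<open>Hom\<close>: the side conditions become equations that rewriting decides,
  whereas \<open>cmp_in_Hom\<close> would require guessing the intermediate object of a
  composite.\<close>

lemma ident_simps [simp]:
  assumes "X \<in> obj C"
  shows "ident C X \<in> arr C" "src C (ident C X) = X" "tgt C (ident C X) = X"
  using ident_in_Hom[OF assms] by (auto simp: Hom_def)

lemma cmp_simps [simp]:
  assumes "f \<in> arr C" "g \<in> arr C" "tgt C f = src C g"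
  shows "g \<cdot> f \<in> arr C" "src C (g \<cdot> f) = src C f" "tgt C (g \<cdot> f) = tgt C g"
  using cmp_in_Hom[of f "src C f" "src C g" g "tgt C g"] assms by (auto simp: Hom_def)

lemma obj_simps [simp]:
  assumes "f \<in> arr C"
  shows "src C f \<in> obj C" "tgt C f \<in> obj C"
  using assms src_in_obj tgt_in_obj by auto

lemma cmp_assoc' [simp]:
  assumes "f \<in> arr C" "g \<in> arr C" "h \<in> arr C" "tgt C f = src C g" "tgt C g = src C h"
  shows "(h \<cdot> g) \<cdot> f = h \<cdot> (g \<cdot> f)"
  using cmp_assoc[of f "src C f" "src C g" g "src C h" h "tgt C h"] assms by (auto simp: Hom_def)

lemma cmp_ident [simp]:
  assumes "f \<in> arr C"
  shows "src C f = X \<Longrightarrow> f \<cdot> ident C X = f" "tgt C f = X \<Longrightarrow> ident C X \<cdot> f = f"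
  using cmp_ident_left cmp_ident_right arr_in_Hom[OF assms] by auto

text \<open>Composites are normalised to the right by \<open>cmp_assoc'\<close>, which hides a
  subterm g f inside g (f x). This form turns an equation for g f into a rewrite rule that still
  applies there.\<close>

lemma cmp_eq_cmp:
  assumes "g \<cdot> f = e" "f \<in> arr C" "g \<in> arr C" "tgt C f = src C g" "x \<in> arr C" "tgt C x = src C f"
  shows "g \<cdot> (f \<cdot> x) = e \<cdot> x"
  using assms cmp_assoc'[of x f g] by simp

lemma is_isoI:
  assumes "f \<in> Hom C X Y" "g \<in> Hom C Y X" "g \<cdot> f = ident C X" "f \<cdot> g = ident C Y"
  shows "is_iso C f"
  using assms by (auto simp: is_iso_def Hom_def)

lemma is_isoE:
  assumes "is_iso C f" "f \<in> Hom C X Y"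
  obtains g where "g \<in> Hom C Y X" "g \<cdot> f = ident C X" "f \<cdot> g = ident C Y"
  using assms by (auto simp: is_iso_def Hom_def)

lemma iso_cancel_right:
  assumes e: "is_iso C e" "e \<in> Hom C X Y" and f: "f \<in> Hom C Y Z" and g: "g \<in> Hom C Y Z"
    and eq: "f \<cdot> e = g \<cdot> e"
  shows "f = g"
proof -
  obtain e' where e': "e' \<in> Hom C Y X" "e \<cdot> e' = ident C Y" using is_isoE[OF e] by metis
  have "k = (k \<cdot> e) \<cdot> e'" if "k \<in> Hom C Y Z" for k
    using cmp_assoc[OF e'(1) e(2) that] e'(2) cmp_ident_right[OF that] by simp
  from this[OF f] this[OF g] show ?thesis unfolding eq by simp
qed

lemma is_iso_ident: "X \<in> obj C \<Longrightarrow> is_iso C (ident C X)"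
  by (rule is_isoI[of _ X X "ident C X"]) (auto simp: ident_in_Hom)

text \<open>The two inverses provide a left inverse a g and a right inverse g b of f, and these
  coincide.\<close>

lemma is_iso_if_both_composites:
  assumes f: "f \<in> Hom C X Y" and g: "g \<in> Hom C Y X"
    and gf: "is_iso C (g \<cdot> f)" and fg: "is_iso C (f \<cdot> g)"
  shows "is_iso C f"
proof -
  obtain a where a: "a \<in> Hom C X X" "a \<cdot> (g \<cdot> f) = ident C X"
    using is_isoE[OF gf cmp_in_Hom[OF f g]] by metis
  obtain b where b: "b \<in> Hom C Y Y" "(f \<cdot> g) \<cdot> b = ident C Y"
    using is_isoE[OF fg cmp_in_Hom[OF g f]] by metis
  note h = HomD[OF f] HomD[OF g] HomD[OF a(1)] HomD[OF b(1)]
  have 1: "(a \<cdot> g) \<cdot> f = ident C X" using h a(2) by simp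
  have 2: "f \<cdot> (g \<cdot> b) = ident C Y" using h b(2) by simp
  have "a \<cdot> g = (a \<cdot> g) \<cdot> (f \<cdot> (g \<cdot> b))" unfolding 2 using h by simp
  also have "\<dots> = ((a \<cdot> g) \<cdot> f) \<cdot> (g \<cdot> b)" using h by simp
  also have "\<dots> = g \<cdot> b" unfolding 1 using h by simp
  finally have "a \<cdot> g = g \<cdot> b" .
  with 1 2 show ?thesis using h
    by (intro is_isoI[OF f, of "a \<cdot> g"]) (auto intro: HomI)
qed

end

context additive_category
begin

section \<open>The group structure on arrows with fixed endpoints\<close>

lemma zero_simps [simp]:
  assumes "X \<in> obj C" "Y \<in> obj C"
  shows "zero_arr C X Y \<in> arr C" "src C (zero_arr C X Y) = X" "tgt C (zero_arr C X Y) = Y"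
proof -
  interpret comm_group "Hom_group C X Y" using Hom_comm_group assms .
  have "zero_arr C X Y \<in> Hom C X Y" using one_closed by (simp add: Hom_group_def)
  then show "zero_arr C X Y \<in> arr C" "src C (zero_arr C X Y) = X" "tgt C (zero_arr C X Y) = Y"
    by (auto simp: Hom_def)
qed

lemma add_simps [simp]:
  assumes "f \<in> arr C" "g \<in> arr C" "src C f = src C g" "tgt C f = tgt C g"
  shows "f \<oplus> g \<in> arr C" "src C (f \<oplus> g) = src C g" "tgt C (f \<oplus> g) = tgt C g"
proof -
  interpret comm_group "Hom_group C (src C g) (tgt C g)" using Hom_comm_group assms by simp
  have "f \<oplus> g \<in> Hom C (src C g) (tgt C g)"
    using m_closed[of f g] assms by (simp add: Hom_group_def Hom_def)
  then show "f \<oplus> g \<in> arr C" "src C (f \<oplus> g) = src C g" "tgt C (f \<oplus> g) = tgt C g"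
    by (auto simp: Hom_def)
qed

lemma neg_simps [simp]:
  assumes "f \<in> arr C"
  shows "neg C f \<in> arr C" "src C (neg C f) = src C f" "tgt C (neg C f) = tgt C f"
proof -
  interpret comm_group "Hom_group C (src C f) (tgt C f)" using Hom_comm_group assms by simp
  have "neg C f \<in> Hom C (src C f) (tgt C f)"
    using inv_closed[of f] assms by (simp add: neg_def Hom_group_def Hom_def)
  then show "neg C f \<in> arr C" "src C (neg C f) = src C f" "tgt C (neg C f) = tgt C f"
    by (auto simp: Hom_def)
qed

lemma add_assoc:
  assumes "f \<in> arr C" "g \<in> arr C" "h \<in> arr C"
    "src C f = src C h" "src C g = src C h" "tgt C f = tgt C h" "tgt C g = tgt C h"
  shows "(f \<oplus> g) \<oplus> h = f \<oplus> (g \<oplus> h)"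
proof -
  interpret comm_group "Hom_group C (src C h) (tgt C h)" using Hom_comm_group assms by simp
  show ?thesis using m_assoc[of f g h] assms by (simp add: Hom_group_def Hom_def)
qed

lemma add_commute:
  assumes "f \<in> arr C" "g \<in> arr C" "src C f = src C g" "tgt C f = tgt C g"
  shows "f \<oplus> g = g \<oplus> f"
proof -
  interpret comm_group "Hom_group C (src C g) (tgt C g)" using Hom_comm_group assms by simp
  show ?thesis using m_comm[of f g] assms by (simp add: Hom_group_def Hom_def)
qed

lemma add_left_commute:
  assumes "f \<in> arr C" "g \<in> arr C" "h \<in> arr C"
    "src C f = src C h" "src C g = src C h" "tgt C f = tgt C h" "tgt C g = tgt C h"
  shows "f \<oplus> (g \<oplus> h) = g \<oplus> (f \<oplus> h)"
  using add_assoc[of f g h] add_assoc[of g f h] add_commute[of f g] assms by simp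

lemma add_zero [simp]:
  assumes "f \<in> arr C" "src C f = X" "tgt C f = Y"
  shows "zero_arr C X Y \<oplus> f = f" "f \<oplus> zero_arr C X Y = f"
proof -
  interpret comm_group "Hom_group C X Y" using Hom_comm_group assms by auto
  show "zero_arr C X Y \<oplus> f = f" "f \<oplus> zero_arr C X Y = f"
    using l_one[of f] r_one[of f] assms by (auto simp: Hom_group_def Hom_def)
qed

lemma add_neg [simp]:
  assumes "f \<in> arr C"
  shows "neg C f \<oplus> f = zero_arr C (src C f) (tgt C f)"
    "f \<oplus> neg C f = zero_arr C (src C f) (tgt C f)"
proof -
  interpret comm_group "Hom_group C (src C f) (tgt C f)" using Hom_comm_group assms by simp
  show "neg C f \<oplus> f = zero_arr C (src C f) (tgt C f)"
    "f \<oplus> neg C f = zero_arr C (src C f) (tgt C f)"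
    using l_inv[of f] r_inv[of f] assms by (auto simp: neg_def Hom_group_def Hom_def)
qed

lemma add_neg_cancel [simp]:
  assumes "f \<in> arr C" "g \<in> arr C" "src C f = src C g" "tgt C f = tgt C g"
  shows "neg C f \<oplus> (f \<oplus> g) = g" "f \<oplus> (neg C f \<oplus> g) = g"
  using assms add_assoc[of "neg C f" f g] add_assoc[of f "neg C f" g] by auto

lemma add_neg_cancel_inner [simp]:
  assumes "f \<in> arr C" "g \<in> arr C" "src C f = src C g" "tgt C f = tgt C g"
  shows "f \<oplus> (g \<oplus> neg C f) = g" "neg C f \<oplus> (g \<oplus> f) = g"
proof -
  have "f \<oplus> (g \<oplus> neg C f) = g \<oplus> (f \<oplus> neg C f)"
    by (rule add_left_commute) (use assms in simp_all)
  then show "f \<oplus> (g \<oplus> neg C f) = g" using assms by simp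
  have "neg C f \<oplus> (g \<oplus> f) = g \<oplus> (neg C f \<oplus> f)"
    by (rule add_left_commute) (use assms in simp_all)
  then show "neg C f \<oplus> (g \<oplus> f) = g" using assms by simp
qed

lemma neg_unique:
  assumes "f \<in> arr C" "g \<in> arr C" "src C f = src C g" "tgt C f = tgt C g"
    and "f \<oplus> g = zero_arr C (src C g) (tgt C g)"
  shows "g = neg C f"
  using add_neg_cancel(1)[of f g] add_zero(2)[of "neg C f" "src C g" "tgt C g"] assms by simp

lemma neg_neg [simp]: "f \<in> arr C \<Longrightarrow> neg C (neg C f) = f"
  using neg_unique[of "neg C f" f] by simp

lemma neg_zero [simp]:
  "\<lbrakk>X \<in> obj C; Y \<in> obj C\<rbrakk> \<Longrightarrow> neg C (zero_arr C X Y) = zero_arr C X Y"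
  using neg_unique[of "zero_arr C X Y" "zero_arr C X Y"] by simp

lemma add_left_cancel:
  assumes "f \<in> arr C" "g \<in> arr C" "h \<in> arr C"
    "src C f = src C h" "src C g = src C h" "tgt C f = tgt C h" "tgt C g = tgt C h"
    and "f \<oplus> g = f \<oplus> h"
  shows "g = h"
proof -
  have "neg C f \<oplus> (f \<oplus> g) = g" "neg C f \<oplus> (f \<oplus> h) = h" using assms(1-7) by simp_all
  then show ?thesis unfolding assms(8) by metis
qed

lemma eq_if_diff_zero:
  assumes "f \<in> arr C" "g \<in> arr C" "src C f = src C g" "tgt C f = tgt C g"
    and "f \<oplus> neg C g = zero_arr C (src C g) (tgt C g)"
  shows "f = g"
  using add_left_cancel[of "neg C g" f g] add_commute[of f "neg C g"] assms by simp

lemma cmp_add [simp]: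
  assumes "f \<in> arr C" "f' \<in> arr C" "src C f = src C f'" "tgt C f = tgt C f'" "g \<in> arr C"
  shows "tgt C f' = src C g \<Longrightarrow> g \<cdot> (f \<oplus> f') = g \<cdot> f \<oplus> g \<cdot> f'"
    "tgt C g = src C f' \<Longrightarrow> (f \<oplus> f') \<cdot> g = f \<cdot> g \<oplus> f' \<cdot> g"
  using cmp_add_right[of f "src C f'" "tgt C f'" f' g "tgt C g"]
    cmp_add_left[of g "src C g" "src C f'" f "tgt C f'" f'] assms
  by (auto simp: Hom_def)

text \<open>Zero is the only idempotent of a group; this is how composition and suspension are seen
  to preserve zero maps.\<close>

lemma idem_zero:
  assumes "f \<in> arr C" "f \<oplus> f = f"
  shows "f = zero_arr C (src C f) (tgt C f)"
  using add_left_cancel[of f f "zero_arr C (src C f) (tgt C f)"] assms by simp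

lemma cmp_zero [simp]:
  assumes "g \<in> arr C" "X \<in> obj C"
  shows "src C g = Y \<Longrightarrow> g \<cdot> zero_arr C X Y = zero_arr C X (tgt C g)"
    "tgt C g = Y \<Longrightarrow> zero_arr C Y X \<cdot> g = zero_arr C (src C g) X"
proof -
  assume Y: "src C g = Y"
  then have Y': "Y \<in> obj C" using assms by auto
  have "g \<cdot> zero_arr C X Y \<oplus> g \<cdot> zero_arr C X Y = g \<cdot> zero_arr C X Y"
    using cmp_add(1)[of "zero_arr C X Y" "zero_arr C X Y" g] assms Y Y' by simp
  then show "g \<cdot> zero_arr C X Y = zero_arr C X (tgt C g)"
    using idem_zero[of "g \<cdot> zero_arr C X Y"] assms Y Y' by simp
next
  assume Y: "tgt C g = Y"
  then have Y': "Y \<in> obj C" using assms by auto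
  have "zero_arr C Y X \<cdot> g \<oplus> zero_arr C Y X \<cdot> g = zero_arr C Y X \<cdot> g"
    using cmp_add(2)[of "zero_arr C Y X" "zero_arr C Y X" g] assms Y Y' by simp
  then show "zero_arr C Y X \<cdot> g = zero_arr C (src C g) X"
    using idem_zero[of "zero_arr C Y X \<cdot> g"] assms Y Y' by simp
qed

lemma cmp_neg [simp]:
  assumes "f \<in> arr C" "g \<in> arr C" "tgt C f = src C g"
  shows "g \<cdot> neg C f = neg C (g \<cdot> f)" "neg C g \<cdot> f = neg C (g \<cdot> f)"
proof -
  have "g \<cdot> (f \<oplus> neg C f) = zero_arr C (src C f) (tgt C g)"
    "(g \<oplus> neg C g) \<cdot> f = zero_arr C (src C f) (tgt C g)"
    using assms by (simp_all del: cmp_add)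
  moreover have "g \<cdot> (f \<oplus> neg C f) = g \<cdot> f \<oplus> g \<cdot> neg C f"
    "(g \<oplus> neg C g) \<cdot> f = g \<cdot> f \<oplus> neg C g \<cdot> f"
    by (rule cmp_add; use assms in simp)+
  ultimately have *: "g \<cdot> f \<oplus> g \<cdot> neg C f = zero_arr C (src C f) (tgt C g)"
    "g \<cdot> f \<oplus> neg C g \<cdot> f = zero_arr C (src C f) (tgt C g)" by metis+
  show "g \<cdot> neg C f = neg C (g \<cdot> f)" "neg C g \<cdot> f = neg C (g \<cdot> f)"
    by (rule neg_unique; use assms * in simp)+
qed

lemma neg_add [simp]:
  assumes "f \<in> arr C" "g \<in> arr C" "src C f = src C g" "tgt C f = tgt C g"
  shows "neg C (f \<oplus> g) = neg C f \<oplus> neg C g"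
proof -
  have "(f \<oplus> g) \<oplus> (neg C f \<oplus> neg C g) = f \<oplus> (g \<oplus> (neg C f \<oplus> neg C g))"
    by (rule add_assoc) (use assms in simp_all)
  also have "\<dots> = zero_arr C (src C g) (tgt C g)" using assms by simp
  finally have "neg C f \<oplus> neg C g = neg C (f \<oplus> g)"
    by (intro neg_unique) (use assms in simp_all)
  then show ?thesis by simp
qed

section \<open>Zero objects and unipotent maps\<close>

lemma zero_obj_unique:
  assumes "is_zero_obj C N"
  shows "N \<in> obj C"
    "f \<in> arr C \<Longrightarrow> tgt C f = N \<Longrightarrow> f = zero_arr C (src C f) N"
proof -
  show N: "N \<in> obj C" using assms by (simp add: is_zero_obj_def)
  show "f = zero_arr C (src C f) N" if "f \<in> arr C" "tgt C f = N"
  proof -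
    have "f \<in> Hom C (src C f) N" "zero_arr C (src C f) N \<in> Hom C (src C f) N"
      using that N by (auto intro!: HomI)
    moreover have "\<exists>!f'. f' \<in> Hom C (src C f) N"
      using assms that unfolding is_zero_obj_def by simp
    ultimately show ?thesis by blast
  qed
qed

text \<open>The universal property becomes an equation between arrows, which any additive functor
  preserves; it is needed for \<Sigma>.\<close>

lemma zero_obj_iff:
  assumes N: "N \<in> obj C"
  shows "is_zero_obj C N \<longleftrightarrow> ident C N = zero_arr C N N"
proof
  assume "is_zero_obj C N"
  then show "ident C N = zero_arr C N N" using zero_obj_unique(2)[of N "ident C N"] N by simp
next
  assume id: "ident C N = zero_arr C N N"
  show "is_zero_obj C N"
    unfolding is_zero_obj_def
  proof (intro conjI ballI N)
    fix X assume X: "X \<in> obj C"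
    have "f = zero_arr C X N" if "f \<in> Hom C X N" for f
      using cmp_ident_left[OF that] HomD[OF that] N by (simp add: id)
    moreover have "zero_arr C X N \<in> Hom C X N" using X N by (auto intro!: HomI)
    ultimately show "\<exists>!f. f \<in> Hom C X N" by blast
    have "f = zero_arr C N X" if "f \<in> Hom C N X" for f
      using cmp_ident_right[OF that] HomD[OF that] N by (simp add: id)
    moreover have "zero_arr C N X \<in> Hom C N X" using X N by (auto intro!: HomI)
    ultimately show "\<exists>!f. f \<in> Hom C N X" by blast
  qed
qed

lemma is_iso_neg:
  assumes "is_iso C f"
  shows "is_iso C (neg C f)"
proof -
  have f: "f \<in> Hom C (src C f) (tgt C f)" using assms by (auto simp: is_iso_def Hom_def)
  then obtain g where "g \<in> Hom C (tgt C f) (src C f)" "g \<cdot> f = ident C (src C f)"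
    "f \<cdot> g = ident C (tgt C f)" using assms is_isoE by blast
  then show ?thesis using f
    by (intro is_isoI[of _ "src C f" "tgt C f" "neg C g"]) (auto simp: Hom_def)
qed

text \<open>(1 - n)(1 + n) = 1 - n n. The inverse is stated explicitly because it is later composed
  with other maps.\<close>

lemma is_iso_unipotent:
  assumes n: "n \<in> Hom C X X" and nn: "n \<cdot> n = zero_arr C X X"
  shows "is_iso C (ident C X \<oplus> n)"
    and "(ident C X \<oplus> neg C n) \<cdot> (ident C X \<oplus> n) = ident C X"
proof -
  note h = HomD[OF n] Hom_obj[OF n]
  show *: "(ident C X \<oplus> neg C n) \<cdot> (ident C X \<oplus> n) = ident C X"
    using h nn by (simp add: add_assoc)
  show "is_iso C (ident C X \<oplus> n)"
    by (rule is_isoI[of _ X X "ident C X \<oplus> neg C n"])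
      (use h nn * in \<open>auto simp: add_assoc intro!: HomI\<close>)
qed

text \<open>The replacement for the five lemma: a composite of fill-ins is compared with the
  identity through its square-zero difference.\<close>

lemma is_iso_if_diff_nilpotent:
  assumes e: "e \<in> Hom C X X"
    and "(e \<oplus> neg C (ident C X)) \<cdot> (e \<oplus> neg C (ident C X)) = zero_arr C X X"
  shows "is_iso C e"
proof -
  note h = HomD[OF e] Hom_obj[OF e]
  have "is_iso C (ident C X \<oplus> (e \<oplus> neg C (ident C X)))"
    by (rule is_iso_unipotent) (use h assms in \<open>auto intro!: HomI\<close>)
  then show ?thesis using h by simp
qed

section \<open>Direct sums and matrices\<close>

lemma dsum_simps [simp]:
  assumes "X \<in> obj C" "Y \<in> obj C"
  shows "dsum C X Y \<in> obj C"
    "in1 C X Y \<in> arr C" "src C (in1 C X Y) = X" "tgt C (in1 C X Y) = dsum C X Y"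
    "in2 C X Y \<in> arr C" "src C (in2 C X Y) = Y" "tgt C (in2 C X Y) = dsum C X Y"
    "pr1 C X Y \<in> arr C" "src C (pr1 C X Y) = dsum C X Y" "tgt C (pr1 C X Y) = X"
    "pr2 C X Y \<in> arr C" "src C (pr2 C X Y) = dsum C X Y" "tgt C (pr2 C X Y) = Y"
    "pr1 C X Y \<cdot> in1 C X Y = ident C X" "pr2 C X Y \<cdot> in2 C X Y = ident C Y"
    "pr1 C X Y \<cdot> in2 C X Y = zero_arr C Y X" "pr2 C X Y \<cdot> in1 C X Y = zero_arr C X Y"
  using dsum_in_obj[OF assms] in1_in_Hom[OF assms] in2_in_Hom[OF assms] pr1_in_Hom[OF assms]
    pr2_in_Hom[OF assms] pr1_in1[OF assms] pr2_in2[OF assms] pr1_in2[OF assms] pr2_in1[OF assms]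
  by (auto simp: Hom_def)

lemma pr_in_cmp [simp]:
  assumes "X \<in> obj C" "Y \<in> obj C" "f \<in> arr C"
  shows "tgt C f = X \<Longrightarrow> pr1 C X Y \<cdot> (in1 C X Y \<cdot> f) = f"
    "tgt C f = Y \<Longrightarrow> pr2 C X Y \<cdot> (in2 C X Y \<cdot> f) = f"
    "tgt C f = Y \<Longrightarrow> pr1 C X Y \<cdot> (in2 C X Y \<cdot> f) = zero_arr C (src C f) X"
    "tgt C f = X \<Longrightarrow> pr2 C X Y \<cdot> (in1 C X Y \<cdot> f) = zero_arr C (src C f) Y"
  using assms by (simp_all add: cmp_eq_cmp[OF dsum_simps(14)] cmp_eq_cmp[OF dsum_simps(15)]
    cmp_eq_cmp[OF dsum_simps(16)] cmp_eq_cmp[OF dsum_simps(17)])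

lemma eq_from_dsumI:
  assumes "f \<in> Hom C (dsum C X Y) W" "g \<in> Hom C (dsum C X Y) W" "X \<in> obj C" "Y \<in> obj C"
    and "f \<cdot> in1 C X Y = g \<cdot> in1 C X Y" "f \<cdot> in2 C X Y = g \<cdot> in2 C X Y"
  shows "f = g"
proof -
  have *: "h = (h \<cdot> in1 C X Y) \<cdot> pr1 C X Y \<oplus> (h \<cdot> in2 C X Y) \<cdot> pr2 C X Y"
    if "h \<in> Hom C (dsum C X Y) W" for h
    using cmp_add(1)[of "in1 C X Y \<cdot> pr1 C X Y" "in2 C X Y \<cdot> pr2 C X Y" h]
      cmp_ident_right[OF that] HomD[OF that] in_pr_sum[OF assms(3,4)] assms(3,4) by simp
  show ?thesis by (subst *[OF assms(1)], subst *[OF assms(2)]) (simp only: assms(5,6))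
qed

lemma eq_to_dsumI:
  assumes "f \<in> Hom C W (dsum C X Y)" "g \<in> Hom C W (dsum C X Y)" "X \<in> obj C" "Y \<in> obj C"
    and "pr1 C X Y \<cdot> f = pr1 C X Y \<cdot> g" "pr2 C X Y \<cdot> f = pr2 C X Y \<cdot> g"
  shows "f = g"
proof -
  have *: "h = in1 C X Y \<cdot> (pr1 C X Y \<cdot> h) \<oplus> in2 C X Y \<cdot> (pr2 C X Y \<cdot> h)"
    if "h \<in> Hom C W (dsum C X Y)" for h
    using cmp_add(2)[of "in1 C X Y \<cdot> pr1 C X Y" "in2 C X Y \<cdot> pr2 C X Y" h]
      cmp_ident_left[OF that] HomD[OF that] in_pr_sum[OF assms(3,4)] assms(3,4) by simp
  show ?thesis by (subst *[OF assms(1)], subst *[OF assms(2)]) (simp only: assms(5,6))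
qed

text \<open>The columns and rows of a matrix are all that later proofs use;
  \<open>matrix_map\<close> is unfolded only here.\<close>

lemma matrix_map_simps:
  assumes "p \<in> Hom C A A'" "q \<in> Hom C B A'" "r \<in> Hom C A B'" "s \<in> Hom C B B'"
  shows "matrix_map C p q r s \<in> Hom C (dsum C A B) (dsum C A' B')"
    "matrix_map C p q r s \<cdot> in1 C A B = in1 C A' B' \<cdot> p \<oplus> in2 C A' B' \<cdot> r"
    "matrix_map C p q r s \<cdot> in2 C A B = in1 C A' B' \<cdot> q \<oplus> in2 C A' B' \<cdot> s"
    "pr1 C A' B' \<cdot> matrix_map C p q r s = p \<cdot> pr1 C A B \<oplus> q \<cdot> pr2 C A B"
    "pr2 C A' B' \<cdot> matrix_map C p q r s = r \<cdot> pr1 C A B \<oplus> s \<cdot> pr2 C A B"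
proof -
  note h = assms[THEN HomD] assms[THEN Hom_obj]
  have M: "matrix_map C p q r s =
    (in1 C A' B' \<cdot> p \<cdot> pr1 C A B \<oplus> in1 C A' B' \<cdot> q \<cdot> pr2 C A B)
      \<oplus> (in2 C A' B' \<cdot> r \<cdot> pr1 C A B \<oplus> in2 C A' B' \<cdot> s \<cdot> pr2 C A B)"
    using h by (simp add: matrix_map_def Let_def)
  show "matrix_map C p q r s \<in> Hom C (dsum C A B) (dsum C A' B')"
    unfolding M by (rule HomI) (use h in simp_all)
  show "matrix_map C p q r s \<cdot> in1 C A B = in1 C A' B' \<cdot> p \<oplus> in2 C A' B' \<cdot> r"
    "matrix_map C p q r s \<cdot> in2 C A B = in1 C A' B' \<cdot> q \<oplus> in2 C A' B' \<cdot> s"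
    "pr1 C A' B' \<cdot> matrix_map C p q r s = p \<cdot> pr1 C A B \<oplus> q \<cdot> pr2 C A B"
    "pr2 C A' B' \<cdot> matrix_map C p q r s = r \<cdot> pr1 C A B \<oplus> s \<cdot> pr2 C A B"
    unfolding M using h by simp_all
qed

end

section \<open>Exact triangles\<close>

context triangulated_category
begin

section \<open>The suspension as an additive equivalence\<close>

lemma susp_simps [simp]:
  "X \<in> obj C \<Longrightarrow> susp_obj C X \<in> obj C"
  "X \<in> obj C \<Longrightarrow> susp C (ident C X) = ident C (susp_obj C X)"
  "f \<in> arr C \<Longrightarrow> susp C f \<in> arr C"
  "f \<in> arr C \<Longrightarrow> src C (susp C f) = susp_obj C (src C f)"
  "f \<in> arr C \<Longrightarrow> tgt C (susp C f) = susp_obj C (tgt C f)"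
  using susp_functor by (auto simp: endofunctor_def Hom_def)

lemma susp_cmp [simp]:
  "\<lbrakk>f \<in> arr C; g \<in> arr C; tgt C f = src C g\<rbrakk> \<Longrightarrow> susp C (g \<cdot> f) = susp C g \<cdot> susp C f"
  using susp_functor by (auto simp: endofunctor_def Hom_def)

lemma desusp_simps [simp]:
  "X \<in> obj C \<Longrightarrow> desusp_obj C X \<in> obj C"
  "X \<in> obj C \<Longrightarrow> desusp C (ident C X) = ident C (desusp_obj C X)"
  "f \<in> arr C \<Longrightarrow> desusp C f \<in> arr C"
  "f \<in> arr C \<Longrightarrow> src C (desusp C f) = desusp_obj C (src C f)"
  "f \<in> arr C \<Longrightarrow> tgt C (desusp C f) = desusp_obj C (tgt C f)"
  using desusp_functor by (auto simp: endofunctor_def Hom_def)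

lemma susp_add [simp]:
  "\<lbrakk>f \<in> arr C; g \<in> arr C; src C f = src C g; tgt C f = tgt C g\<rbrakk>
    \<Longrightarrow> susp C (f \<oplus> g) = susp C f \<oplus> susp C g"
  using susp_additive[of f "src C g" "tgt C g" g] by (simp add: Hom_def)

lemma susp_zero [simp]:
  assumes "X \<in> obj C" "Y \<in> obj C"
  shows "susp C (zero_arr C X Y) = zero_arr C (susp_obj C X) (susp_obj C Y)"
proof -
  have "susp C (zero_arr C X Y) \<oplus> susp C (zero_arr C X Y) = susp C (zero_arr C X Y)"
    using susp_add[of "zero_arr C X Y" "zero_arr C X Y"] assms by simp
  then show ?thesis using idem_zero[of "susp C (zero_arr C X Y)"] assms by simp
qed

lemma susp_neg [simp]:
  assumes "f \<in> arr C"
  shows "susp C (neg C f) = neg C (susp C f)"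
proof (rule neg_unique)
  have "susp C f \<oplus> susp C (neg C f) = susp C (f \<oplus> neg C f)"
    using assms by (simp del: add_neg)
  also have "\<dots> = zero_arr C (src C (susp C (neg C f))) (tgt C (susp C (neg C f)))"
    using assms by simp
  finally show "susp C f \<oplus> susp C (neg C f) =
    zero_arr C (src C (susp C (neg C f))) (tgt C (susp C (neg C f)))" .
qed (use assms in simp_all)

lemma unit_simps [simp]:
  assumes "X \<in> obj C"
  shows "unit C X \<in> arr C" "src C (unit C X) = X"
    "tgt C (unit C X) = susp_obj C (desusp_obj C X)" "is_iso C (unit C X)"
  using unit_iso assms by (auto simp: natural_iso_def Hom_def)

lemma counit_simps [simp]:
  assumes "X \<in> obj C"
  shows "counit C X \<in> arr C" "tgt C (counit C X) = X"
    "src C (counit C X) = desusp_obj C (susp_obj C X)" "is_iso C (counit C X)"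
  using counit_iso assms by (auto simp: natural_iso_def Hom_def)

lemma unit_natural:
  "f \<in> Hom C X Y \<Longrightarrow> unit C Y \<cdot> f = susp C (desusp C f) \<cdot> unit C X"
  using unit_iso by (simp add: natural_iso_def)

lemma counit_natural:
  "f \<in> Hom C X Y \<Longrightarrow> counit C Y \<cdot> desusp C (susp C f) = f \<cdot> counit C X"
  using counit_iso by (simp add: natural_iso_def)

text \<open>Naturality of the counit recovers f, up to the invertible \<open>counit C X\<close>,
  from the suspension of f.\<close>

lemma susp_faithful:
  assumes f: "f \<in> Hom C X Y" and g: "g \<in> Hom C X Y" and eq: "susp C f = susp C g"
  shows "f = g"
proof -
  note h = HomD[OF f] HomD[OF g] Hom_obj[OF f]
  have *: "f \<cdot> counit C X = g \<cdot> counit C X"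
    using counit_natural[OF f] counit_natural[OF g] eq by simp
  show ?thesis
    by (rule iso_cancel_right[OF counit_simps(4)[of X], where Z = Y])
      (use h * in \<open>auto intro!: HomI\<close>)
qed

text \<open>The preimage of F is its desuspension conjugated by the counit, with e the inverse of
  \<open>counit C X\<close>.\<close>

lemma susp_full:
  assumes F: "F \<in> Hom C (susp_obj C X) (susp_obj C Y)" and XY: "X \<in> obj C" "Y \<in> obj C"
  obtains f where "f \<in> Hom C X Y" "susp C f = F"
proof -
  note h = HomD[OF F] XY
  obtain e where e: "e \<in> Hom C X (desusp_obj C (susp_obj C X))"
    "e \<cdot> counit C X = ident C (desusp_obj C (susp_obj C X))"
    "counit C X \<cdot> e = ident C X"
    using is_isoE[OF counit_simps(4), of X "desusp_obj C (susp_obj C X)" X] h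
    by (metis HomI counit_simps(1-3))
  note e' = HomD[OF e(1)]
  \<comment> \<open>The triangle identity identifies the unit at \<Sigma>X with the suspension of e,
    so naturality of the unit can be applied to F below.\<close>
  have "susp C (e \<cdot> counit C X) \<cdot> unit C (susp_obj C X) = unit C (susp_obj C X)"
    unfolding e(2) using h by simp
  then have unit: "unit C (susp_obj C X) = susp C e"
    using h e' triangle_identity_susp[of X] by simp
  have "susp C (counit C Y \<cdot> desusp C F \<cdot> e) =
    susp C (counit C Y) \<cdot> (susp C (desusp C F) \<cdot> unit C (susp_obj C X))"
    unfolding unit using h e' by simp
  also have "\<dots> = (susp C (counit C Y) \<cdot> unit C (susp_obj C Y)) \<cdot> F"
    unfolding unit_natural[OF F, symmetric] using h by simp
  also have "\<dots> = F"
    unfolding triangle_identity_susp[OF XY(2)] using h by simp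
  finally show ?thesis
    using h e' by (intro that[of "counit C Y \<cdot> desusp C F \<cdot> e"]) (auto intro!: HomI)
qed

section \<open>Exact triangles: vanishing composites, weak kernels and weak cokernels\<close>

lemma exactD:
  assumes "(u, v, w) \<in> exact C"
  shows "u \<in> arr C" "v \<in> arr C" "w \<in> arr C"
    "src C v = tgt C u" "src C w = tgt C v" "tgt C w = susp_obj C (src C u)"
  using exact_candidate[OF assms] by (auto simp: candidate_triangle_def Hom_def)

lemma exact_fill:
  assumes "(u, v, w) \<in> exact C" "(u', v', w') \<in> exact C"
    and "f \<in> Hom C (src C u) (src C u')" "g \<in> Hom C (tgt C u) (tgt C u')" "g \<cdot> u = u' \<cdot> f"
  obtains h where "h \<in> Hom C (tgt C v) (tgt C v')" "h \<cdot> v = v' \<cdot> g"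
    "susp C f \<cdot> w = w' \<cdot> h"
  using fill_in_exists[OF assms(1-3)] assms(4,5) exactD[OF assms(1)] exactD[OF assms(2)]
  by (auto simp: fill_in_def triangle_map_def commuting_triple_def)

lemma exact_fill_Hom:
  assumes "(u, v, w) \<in> exact C" "(u', v', w') \<in> exact C"
    and "u \<in> Hom C X Y" "v \<in> Hom C Y Z" "u' \<in> Hom C X' Y'" "v' \<in> Hom C Y' Z'"
    and "f \<in> Hom C X X'" "g \<in> Hom C Y Y'" "g \<cdot> u = u' \<cdot> f"
  obtains h where "h \<in> Hom C Z Z'" "h \<cdot> v = v' \<cdot> g" "susp C f \<cdot> w = w' \<cdot> h"
  using exact_fill[OF assms(1,2), of f g] assms(3-9) by (simp add: Hom_def) metis

lemma rotate:
  assumes "(u, v, w) \<in> exact C"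
  shows "(v, w, neg C (susp C u)) \<in> exact C"
  using exact_rotate exact_candidate assms by blast

lemma exact_iso:
  assumes T: "(u, v, w) \<in> exact C"
    and T': "u' \<in> Hom C X' Y'" "v' \<in> Hom C Y' Z'" "w' \<in> Hom C Z' (susp_obj C X')"
    and maps: "f \<in> Hom C (src C u) X'" "g \<in> Hom C (tgt C u) Y'" "h \<in> Hom C (tgt C v) Z'"
    and isos: "is_iso C f" "is_iso C g" "is_iso C h"
    and comm: "g \<cdot> u = u' \<cdot> f" "h \<cdot> v = v' \<cdot> g" "susp C f \<cdot> w = w' \<cdot> h"
  shows "(u', v', w') \<in> exact C"
proof (rule exact_iso_closed[OF T _ _ isos])
  show "candidate_triangle C (u', v', w')" using T' by (auto simp: candidate_triangle_def)
  show "commuting_triple C (u, v, w) (u', v', w') f g h"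
    using exactD[OF T] T' maps comm by (auto simp: commuting_triple_def Hom_def)
qed

text \<open>Its rotation is the identity triangle on W with third object \<Sigma>N, again a zero
  object.\<close>

lemma exact_zero_ident:
  assumes N: "is_zero_obj C N" and W: "W \<in> obj C"
  shows "(zero_arr C N W, ident C W, zero_arr C W (susp_obj C N)) \<in> exact C"
proof -
  have N': "N \<in> obj C" using N zero_obj_unique by blast
  have "ident C (susp_obj C N) = susp C (ident C N)" using N' by simp
  also have "\<dots> = zero_arr C (susp_obj C N) (susp_obj C N)"
    using N' N zero_obj_iff[OF N'] by simp
  finally have "is_zero_obj C (susp_obj C N)" using N' zero_obj_iff by simp
  from exact_ident[OF W this]
  have "(ident C W, zero_arr C W (susp_obj C N), neg C (susp C (zero_arr C N W))) \<in> exact C"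
    using N' W by simp
  moreover have "candidate_triangle C (zero_arr C N W, ident C W, zero_arr C W (susp_obj C N))"
    using N' W by (auto simp: candidate_triangle_def Hom_def)
  ultimately show ?thesis using exact_rotate by blast
qed

text \<open>Map the identity triangle on the source of u to T by the pair 1, u. The fill-in starts
  at a zero object, and v u factors through it.\<close>

lemma exact_cmp_zero:
  assumes T: "(u, v, w) \<in> exact C"
  shows "v \<cdot> u = zero_arr C (src C u) (tgt C v)"
proof -
  note d = exactD[OF T]
  obtain N where N: "is_zero_obj C N" using zero_obj_exists by blast
  obtain h where h: "h \<in> Hom C N (tgt C v)" "h \<cdot> zero_arr C (src C u) N = v \<cdot> u"
    using exact_fill[OF exact_ident[of "src C u" N] T, of "ident C (src C u)" u] N d
      zero_obj_unique(1)[OF N] by (auto simp: Hom_def)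
  then show ?thesis using d zero_obj_unique(1)[OF N] HomD[OF h(1)] by simp
qed

lemma exact_cmp_zero':
  assumes T: "(u, v, w) \<in> exact C"
  shows "w \<cdot> v = zero_arr C (src C v) (tgt C w)"
    "susp C u \<cdot> w = zero_arr C (src C w) (susp_obj C (tgt C u))"
proof -
  note d = exactD[OF T]
  show "w \<cdot> v = zero_arr C (src C v) (tgt C w)"
    using exact_cmp_zero[OF rotate[OF T]] .
  have *: "neg C (susp C u) \<cdot> w = zero_arr C (src C w) (susp_obj C (tgt C u))"
    using exact_cmp_zero[OF rotate[OF rotate[OF T]]] d by simp
  have "susp C u \<cdot> w = neg C (neg C (susp C u) \<cdot> w)" using d by simp
  also have "\<dots> = zero_arr C (src C w) (susp_obj C (tgt C u))"
    unfolding * using d by simp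
  finally show "susp C u \<cdot> w = zero_arr C (src C w) (susp_obj C (tgt C u))" .
qed

text \<open>The factorisation is a fill-in from T to the triangle with maps 0 -> W = W.\<close>

lemma weak_cokernel:
  assumes T: "(u, v, w) \<in> exact C" and f: "f \<in> Hom C (tgt C u) W"
    and fu: "f \<cdot> u = zero_arr C (src C u) W"
  obtains s where "s \<in> Hom C (tgt C v) W" "f = s \<cdot> v"
proof -
  note d = exactD[OF T] HomD[OF f] Hom_obj[OF f]
  obtain N where N: "is_zero_obj C N" using zero_obj_exists by blast
  note N' = zero_obj_unique(1)[OF N]
  show ?thesis
  proof (rule exact_fill[OF T exact_zero_ident[OF N], of W "zero_arr C (src C u) N" f])
    fix h assume "h \<in> Hom C (tgt C v) (tgt C (ident C W))" "h \<cdot> v = ident C W \<cdot> f"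
    then show ?thesis using d by (intro that[of h]) auto
  qed (use d N' fu in \<open>auto intro!: HomI\<close>)
qed

text \<open>Dual to the weak cokernel, but the fill-in from the rotated identity triangle on W to
  the rotated T has source \<Sigma>W, so it has to be desuspended. The signs of the two rotations
  cancel.\<close>

lemma weak_kernel:
  assumes T: "(u, v, w) \<in> exact C" and g: "g \<in> Hom C W (src C v)"
    and vg: "v \<cdot> g = zero_arr C W (tgt C v)"
  obtains f where "f \<in> Hom C W (src C u)" "g = u \<cdot> f"
proof -
  note d = exactD[OF T] HomD[OF g] Hom_obj[OF g]
  obtain N where N: "is_zero_obj C N" using zero_obj_exists by blast
  note N' = zero_obj_unique(1)[OF N]
  show ?thesis
  proof (rule exact_fill[OF rotate[OF exact_ident[of W N]] rotate[OF T],
        of g "zero_arr C N (tgt C v)"])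
    fix h
    assume "h \<in> Hom C (tgt C (zero_arr C N (susp_obj C W))) (tgt C w)"
      and *: "susp C g \<cdot> neg C (susp C (ident C W)) = neg C (susp C u) \<cdot> h"
    then have "h \<in> Hom C (susp_obj C W) (susp_obj C (src C u))" using d N' by simp
    then obtain f where f: "f \<in> Hom C W (src C u)" "susp C f = h"
      using susp_full d by (metis obj_simps(1))
    have "neg C (susp C g) = neg C (susp C u \<cdot> susp C f)"
      using * d HomD[OF f(1)] unfolding f(2)[symmetric] by simp
    then have "neg C (neg C (susp C g)) = neg C (neg C (susp C (u \<cdot> f)))"
      using d HomD[OF f(1)] by simp
    then have *: "susp C g = susp C (u \<cdot> f)" using d HomD[OF f(1)] by (simp del: susp_cmp)
    have "g = u \<cdot> f"
      by (rule susp_faithful[of _ W "tgt C u", OF _ _ *])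
        (use d HomD[OF f(1)] in \<open>auto intro!: HomI\<close>)
    then show ?thesis using that f by blast
  qed (use d N N' vg in \<open>auto intro!: HomI\<close>)
qed

section \<open>New exact triangles and octahedra from old ones\<close>

lemma susp_dsum_simps [simp]:
  assumes "X \<in> obj C" "Y \<in> obj C"
  shows "susp_dsum C X Y \<in> arr C"
    "src C (susp_dsum C X Y) = dsum C (susp_obj C X) (susp_obj C Y)"
    "tgt C (susp_dsum C X Y) = susp_obj C (dsum C X Y)"
    "susp_dsum C X Y \<cdot> in1 C (susp_obj C X) (susp_obj C Y) = susp C (in1 C X Y)"
    "susp_dsum C X Y \<cdot> in2 C (susp_obj C X) (susp_obj C Y) = susp C (in2 C X Y)"
  using assms by (simp_all add: susp_dsum_def)

text \<open>U, V and W are prescribed by their columns, which lets the result apply directly to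
  mapping cones, whose last map also contains \<open>susp_dsum\<close>. The candidate is compared in
  both directions with an exact triangle completing U.\<close>

lemma exact_dsum:
  assumes T1: "(u1, v1, w1) \<in> exact C" and T2: "(u2, v2, w2) \<in> exact C"
    and m1: "u1 \<in> Hom C X1 Y1" "v1 \<in> Hom C Y1 Z1"
    and m2: "u2 \<in> Hom C X2 Y2" "v2 \<in> Hom C Y2 Z2"
    and U: "U \<in> Hom C (dsum C X1 X2) (dsum C Y1 Y2)"
      "U \<cdot> in1 C X1 X2 = in1 C Y1 Y2 \<cdot> u1" "U \<cdot> in2 C X1 X2 = in2 C Y1 Y2 \<cdot> u2"
    and V: "V \<in> Hom C (dsum C Y1 Y2) (dsum C Z1 Z2)"
      "V \<cdot> in1 C Y1 Y2 = in1 C Z1 Z2 \<cdot> v1" "V \<cdot> in2 C Y1 Y2 = in2 C Z1 Z2 \<cdot> v2"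
    and W: "W \<in> Hom C (dsum C Z1 Z2) (susp_obj C (dsum C X1 X2))"
      "W \<cdot> in1 C Z1 Z2 = susp C (in1 C X1 X2) \<cdot> w1"
      "W \<cdot> in2 C Z1 Z2 = susp C (in2 C X1 X2) \<cdot> w2"
  shows "(U, V, W) \<in> exact C"
proof -
  note o = Hom_obj[OF m1(1)] Hom_obj[OF m1(2)] Hom_obj[OF m2(1)] Hom_obj[OF m2(2)]
  have w: "w1 \<in> arr C" "src C w1 = Z1" "tgt C w1 = susp_obj C X1"
    "w2 \<in> arr C" "src C w2 = Z2" "tgt C w2 = susp_obj C X2"
    using exactD[OF T1] exactD[OF T2] m1 m2 by (simp_all add: Hom_def)
  note h0 = o w HomD[OF m1(1)] HomD[OF m1(2)] HomD[OF m2(1)] HomD[OF m2(2)]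
    HomD[OF U(1)] HomD[OF V(1)] HomD[OF W(1)]
  have nestV1: "V \<cdot> (in1 C Y1 Y2 \<cdot> y) = in1 C Z1 Z2 \<cdot> (v1 \<cdot> y)"
    if "y \<in> arr C" "tgt C y = Y1" for y
    using that h0 cmp_eq_cmp[OF V(2), of y] by simp
  have nestV2: "V \<cdot> (in2 C Y1 Y2 \<cdot> y) = in2 C Z1 Z2 \<cdot> (v2 \<cdot> y)"
    if "y \<in> arr C" "tgt C y = Y2" for y
    using that h0 cmp_eq_cmp[OF V(3), of y] by simp
  have nestW1: "W \<cdot> (in1 C Z1 Z2 \<cdot> z) = susp C (in1 C X1 X2) \<cdot> (w1 \<cdot> z)"
    if "z \<in> arr C" "tgt C z = Z1" for z
    using that h0 cmp_eq_cmp[OF W(2), of z] by simp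
  have nestW2: "W \<cdot> (in2 C Z1 Z2 \<cdot> z) = susp C (in2 C X1 X2) \<cdot> (w2 \<cdot> z)"
    if "z \<in> arr C" "tgt C z = Z2" for z
    using that h0 cmp_eq_cmp[OF W(3), of z] by simp
  \<comment> \<open>The rows follow from the columns; they make the projections compatible with the
    triangles.\<close>
  have prU: "pr1 C Y1 Y2 \<cdot> U = u1 \<cdot> pr1 C X1 X2" "pr2 C Y1 Y2 \<cdot> U = u2 \<cdot> pr2 C X1 X2"
    by (rule eq_from_dsumI[of _ X1 X2]; use h0 U(2,3) in \<open>simp add: Hom_def\<close>)+
  have prV: "pr1 C Z1 Z2 \<cdot> V = v1 \<cdot> pr1 C Y1 Y2" "pr2 C Z1 Z2 \<cdot> V = v2 \<cdot> pr2 C Y1 Y2"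
    by (rule eq_from_dsumI[of _ Y1 Y2]; use h0 V(2,3) in \<open>simp add: Hom_def\<close>)+
  obtain P Q where T: "(U, P, Q) \<in> exact C" using exact_extend h0 by blast
  define K where "K = tgt C P"
  have PQ: "P \<in> arr C" "src C P = dsum C Y1 Y2" "tgt C P = K" "K \<in> obj C"
    "Q \<in> arr C" "src C Q = K" "tgt C Q = susp_obj C (dsum C X1 X2)"
    using exactD[OF T] h0 by (auto simp: K_def)
  have P: "P \<in> Hom C (dsum C Y1 Y2) K" using PQ by (simp add: Hom_def)
  obtain h1 where h1: "h1 \<in> Hom C Z1 K" "h1 \<cdot> v1 = P \<cdot> in1 C Y1 Y2"
    "susp C (in1 C X1 X2) \<cdot> w1 = Q \<cdot> h1"
    using exact_fill_Hom[OF T1 T m1 U(1) P in1_in_Hom in1_in_Hom U(2)[symmetric]] o by metis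
  obtain h2 where h2: "h2 \<in> Hom C Z2 K" "h2 \<cdot> v2 = P \<cdot> in2 C Y1 Y2"
    "susp C (in2 C X1 X2) \<cdot> w2 = Q \<cdot> h2"
    using exact_fill_Hom[OF T2 T m2 U(1) P in2_in_Hom in2_in_Hom U(3)[symmetric]] o by metis
  obtain k1 where k1: "k1 \<in> Hom C K Z1" "k1 \<cdot> P = v1 \<cdot> pr1 C Y1 Y2"
    "susp C (pr1 C X1 X2) \<cdot> Q = w1 \<cdot> k1"
    using exact_fill_Hom[OF T T1 U(1) P m1 pr1_in_Hom pr1_in_Hom prU(1)] o by metis
  obtain k2 where k2: "k2 \<in> Hom C K Z2" "k2 \<cdot> P = v2 \<cdot> pr2 C Y1 Y2"
    "susp C (pr2 C X1 X2) \<cdot> Q = w2 \<cdot> k2"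
    using exact_fill_Hom[OF T T2 U(1) P m2 pr2_in_Hom pr2_in_Hom prU(2)] o by metis
  note hk = h0 PQ HomD[OF h1(1)] HomD[OF h2(1)] HomD[OF k1(1)] HomD[OF k2(1)]
  \<comment> \<open>The fill-ins over the inclusions assemble to h, those over the projections to k.
    Both are compatible with the remaining maps, but as fill-ins are not unique they need not be
    mutually inverse.\<close>
  define h where "h = h1 \<cdot> pr1 C Z1 Z2 \<oplus> h2 \<cdot> pr2 C Z1 Z2"
  define k where "k = in1 C Z1 Z2 \<cdot> k1 \<oplus> in2 C Z1 Z2 \<cdot> k2"
  have h: "h \<in> Hom C (dsum C Z1 Z2) K" using hk by (auto simp: h_def intro!: HomI)
  have k: "k \<in> Hom C K (dsum C Z1 Z2)" using hk by (auto simp: k_def intro!: HomI)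
  have hV: "h \<cdot> V = P"
    by (rule eq_from_dsumI[of _ Y1 Y2 K])
      (use hk HomD[OF h] in \<open>simp_all add: Hom_def h_def V h1(2) h2(2)\<close>)
  have Qh: "Q \<cdot> h = W"
    by (rule eq_from_dsumI[of _ Z1 Z2 "susp_obj C (dsum C X1 X2)"])
      (use hk HomD[OF h] in \<open>simp_all add: Hom_def h_def W h1(3) h2(3)\<close>)
  have kP: "k \<cdot> P = V"
    by (rule eq_to_dsumI[of _ "dsum C Y1 Y2" Z1 Z2])
      (use hk HomD[OF k] in \<open>simp_all add: Hom_def k_def prV k1(2) k2(2)\<close>)
  \<comment> \<open>Additivity of \<Sigma> enters here: it suspends the decomposition of the
    identity of the direct sum.\<close>
  have "W \<cdot> k = susp C (in1 C X1 X2) \<cdot> (susp C (pr1 C X1 X2) \<cdot> Q) \<oplus>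
      susp C (in2 C X1 X2) \<cdot> (susp C (pr2 C X1 X2) \<cdot> Q)"
    using hk by (simp add: k_def nestW1 nestW2 k1(3) k2(3))
  also have "\<dots> = susp C (in1 C X1 X2 \<cdot> pr1 C X1 X2 \<oplus> in2 C X1 X2 \<cdot> pr2 C X1 X2) \<cdot> Q"
    using hk by simp
  also have "\<dots> = Q" using hk in_pr_sum[of X1 X2] by simp
  finally have Wk: "W \<cdot> k = Q" .
  note hk' = hk HomD[OF h] HomD[OF k]
  \<comment> \<open>A difference \<open>n\<close> of two fill-ins kills \<open>V\<close>, so it factors through \<open>W\<close>; since also \<open>W \<cdot> n = 0\<close>,
    it squares to zero.\<close>
  have "is_iso C (k \<cdot> h)"
  proof (rule is_iso_if_diff_nilpotent)
    define n where "n = k \<cdot> h \<oplus> neg C (ident C (dsum C Z1 Z2))"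
    show "k \<cdot> h \<in> Hom C (dsum C Z1 Z2) (dsum C Z1 Z2)" using hk' by (auto intro!: HomI)
    have n: "n \<in> arr C" "src C n = dsum C Z1 Z2" "tgt C n = dsum C Z1 Z2"
      using hk' by (simp_all add: n_def)
    have nV: "n \<cdot> V = zero_arr C (dsum C Y1 Y2) (dsum C Z1 Z2)"
      using hk' by (simp add: n_def hV kP)
    have Wn: "W \<cdot> n = zero_arr C (dsum C Z1 Z2) (susp_obj C (dsum C X1 X2))"
      using hk' cmp_eq_cmp[OF Wk, of h] by (simp add: n_def Qh)
    have "(n \<cdot> in1 C Z1 Z2) \<cdot> v1 = (n \<cdot> V) \<cdot> in1 C Y1 Y2"
      "(n \<cdot> in2 C Z1 Z2) \<cdot> v2 = (n \<cdot> V) \<cdot> in2 C Y1 Y2"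
      using hk' n V by simp_all
    then have "(n \<cdot> in1 C Z1 Z2) \<cdot> v1 = zero_arr C Y1 (dsum C Z1 Z2)"
      "(n \<cdot> in2 C Z1 Z2) \<cdot> v2 = zero_arr C Y2 (dsum C Z1 Z2)"
      unfolding nV using hk' by simp_all
    then obtain s1 s2 where s: "s1 \<in> Hom C (susp_obj C X1) (dsum C Z1 Z2)"
      "s2 \<in> Hom C (susp_obj C X2) (dsum C Z1 Z2)"
      "n \<cdot> in1 C Z1 Z2 = s1 \<cdot> w1" "n \<cdot> in2 C Z1 Z2 = s2 \<cdot> w2"
      using weak_cokernel[OF rotate[OF T1], of "n \<cdot> in1 C Z1 Z2" "dsum C Z1 Z2"]
        weak_cokernel[OF rotate[OF T2], of "n \<cdot> in2 C Z1 Z2" "dsum C Z1 Z2"] hk' n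
      by (simp add: Hom_def) metis
    \<comment> \<open>Exactness of (U, V, W) is still the goal, so the factorisation of n through W
      is glued from weak cokernels in the two summands.\<close>
    define S where "S = s1 \<cdot> susp C (pr1 C X1 X2) \<oplus> s2 \<cdot> susp C (pr2 C X1 X2)"
    have S: "S \<in> arr C" "src C S = susp_obj C (dsum C X1 X2)" "tgt C S = dsum C Z1 Z2"
      using hk' HomD[OF s(1)] HomD[OF s(2)] by (simp_all add: S_def)
    have pr_in: "susp C (pr1 C X1 X2) \<cdot> (susp C (in1 C X1 X2) \<cdot> w1) = w1"
      "susp C (pr2 C X1 X2) \<cdot> (susp C (in2 C X1 X2) \<cdot> w2) = w2"
      "susp C (pr1 C X1 X2) \<cdot> (susp C (in2 C X1 X2) \<cdot> w2) = zero_arr C Z2 (susp_obj C X1)"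
      "susp C (pr2 C X1 X2) \<cdot> (susp C (in1 C X1 X2) \<cdot> w1) = zero_arr C Z1 (susp_obj C X2)"
      using hk' by (simp_all flip: cmp_assoc' susp_cmp)
    have "n = S \<cdot> W"
      by (rule eq_from_dsumI[of _ Z1 Z2 "dsum C Z1 Z2"])
        (use hk' n S HomD[OF s(1)] HomD[OF s(2)] in
          \<open>simp_all add: Hom_def W s(3,4) S_def pr_in\<close>)
    then have "n \<cdot> n = S \<cdot> (W \<cdot> n)" using hk' S n by (metis cmp_assoc')
    then show "(k \<cdot> h \<oplus> neg C (ident C (dsum C Z1 Z2))) \<cdot>
        (k \<cdot> h \<oplus> neg C (ident C (dsum C Z1 Z2))) = zero_arr C (dsum C Z1 Z2) (dsum C Z1 Z2)"
      unfolding n_def[symmetric] Wn using hk' S by simp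
  qed
  moreover have "is_iso C (h \<cdot> k)"
  proof (rule is_iso_if_diff_nilpotent)
    define n where "n = h \<cdot> k \<oplus> neg C (ident C K)"
    show "h \<cdot> k \<in> Hom C K K" using hk' by (auto intro!: HomI)
    have n: "n \<in> arr C" "src C n = K" "tgt C n = K"
      using hk' by (simp_all add: n_def)
    have "n \<cdot> P = zero_arr C (dsum C Y1 Y2) K" using hk' by (simp add: n_def kP hV)
    then obtain s where s: "s \<in> Hom C (susp_obj C (dsum C X1 X2)) K" "n = s \<cdot> Q"
      using weak_cokernel[OF rotate[OF T], of n K] n hk' by (auto simp: Hom_def)
    have Qn: "Q \<cdot> n = zero_arr C K (susp_obj C (dsum C X1 X2))"
      using hk' cmp_eq_cmp[OF Qh, of k] by (simp add: n_def Wk)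
    have "n \<cdot> n = s \<cdot> (Q \<cdot> n)" using hk' n s HomD[OF s(1)] by (metis cmp_assoc')
    then show "(h \<cdot> k \<oplus> neg C (ident C K)) \<cdot> (h \<cdot> k \<oplus> neg C (ident C K)) = zero_arr C K K"
      unfolding n_def[symmetric] Qn using hk' HomD[OF s(1)] by simp
  qed
  ultimately have "is_iso C k" using is_iso_if_both_composites[OF k h] by blast
  then show ?thesis
    by (intro exact_iso[OF T U(1) V(1) W(1), of "ident C (dsum C X1 X2)" "ident C (dsum C Y1 Y2)" k])
      (use hk' in \<open>auto simp: kP Wk is_iso_ident intro!: HomI\<close>)
qed

text \<open>Multiplying the middle object of the rotated triangle by -1 changes the first two signs.
  The result is the second diagonal of a mapping cone.\<close>

lemma exact_rotate_neg:
  assumes T: "(u, v, w) \<in> exact C"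
  shows "(neg C v, neg C w, neg C (susp C u)) \<in> exact C"
proof -
  note d = exactD[OF T]
  show ?thesis
    by (rule exact_iso[OF rotate[OF T], where f = "ident C (src C v)"
          and g = "neg C (ident C (tgt C v))" and h = "ident C (tgt C w)"
          and X' = "src C v" and Y' = "tgt C v" and Z' = "tgt C w"])
      (use d in \<open>auto simp: is_iso_ident is_iso_neg intro!: HomI\<close>)
qed

text \<open>Changing the third object Z by its unit gives a triangle isomorphic to T that is the
  forward rotation of the claimed one.\<close>

lemma exact_rotate_back:
  assumes T: "(u, v, w) \<in> exact C"
  shows "rotate_back C (u, v, w) \<in> exact C"
proof -
  note d = exactD[OF T]
  let ?X = "src C u" and ?Z = "tgt C v"
  have w: "w \<in> Hom C ?Z (susp_obj C ?X)" using d by (auto intro!: HomI)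
  \<comment> \<open>Naturality of the unit moves it past w; the triangle identity then cancels it
    against the counit.\<close>
  have "(susp C (counit C ?X) \<cdot> susp C (desusp C w)) \<cdot> unit C ?Z =
      (susp C (counit C ?X) \<cdot> unit C (susp_obj C ?X)) \<cdot> w"
    using unit_natural[OF w] d by simp
  also have "\<dots> = w" using d triangle_identity_susp[of ?X] by simp
  finally have *: "(susp C (counit C ?X) \<cdot> susp C (desusp C w)) \<cdot> unit C ?Z = w" .
  have "(u, unit C ?Z \<cdot> v, susp C (counit C ?X) \<cdot> susp C (desusp C w)) \<in> exact C"
    by (rule exact_iso[OF T, where f = "ident C ?X" and g = "ident C (tgt C u)"
          and h = "unit C ?Z" and X' = ?X and Y' = "tgt C u"
          and Z' = "susp_obj C (desusp_obj C ?Z)"])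
      (use d * in \<open>auto simp: is_iso_ident intro!: HomI\<close>)
  moreover have "candidate_triangle C (rotate_back C (u, v, w))"
    using d by (auto simp: rotate_back_def candidate_triangle_def Hom_def)
  ultimately show ?thesis using d unfolding rotate_back_def by (simp add: exact_rotate)
qed

text \<open>The middle vertex of an octahedron may be moved by the unipotent automorphism \<open>1 + p s q\<close>.\<close>

lemma octahedron_conjugate:
  assumes oct: "octahedron C (x, x', x'') (y, y', y'') (z, p, q) \<alpha> \<beta> \<gamma>"
    and s: "s \<in> Hom C (tgt C q) (src C p)"
  shows "octahedron C (x, x', x'') (y, y', y'') (z, p, q) (\<alpha> \<oplus> p \<cdot> s \<cdot> x'')
    (\<beta> \<oplus> neg C (y' \<cdot> s \<cdot> q)) \<gamma>"
proof -
  have T: "(x, x', x'') \<in> exact C" "(y, y', y'') \<in> exact C" "(z, p, q) \<in> exact C"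
    "(\<alpha>, \<beta>, \<gamma>) \<in> exact C" and yx: "tgt C x = src C y" "z = y \<cdot> x"
    and homs: "\<alpha> \<in> Hom C (tgt C x') (tgt C p)" "\<beta> \<in> Hom C (tgt C p) (tgt C y')"
      "\<gamma> \<in> Hom C (tgt C y') (susp_obj C (tgt C x'))"
    and eqs: "\<alpha> \<cdot> x' = p \<cdot> y" "q \<cdot> \<alpha> = x''" "\<beta> \<cdot> p = y'" "\<gamma> = susp C x' \<cdot> y''"
      "y'' \<cdot> \<beta> = susp C x \<cdot> q"
    using oct unfolding octahedron_def prod.case by blast+
  define A where "A = tgt C p"
  note d = exactD[OF T(1)] exactD[OF T(2)] exactD[OF T(3), folded A_def]
  have z: "src C z = src C x" "tgt C z = tgt C y" "tgt C p = A"
    using d yx by (simp_all add: A_def)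
  note h = d z HomD[OF homs(1), folded A_def] HomD[OF homs(2), folded A_def] HomD[OF homs(3)]
    HomD[OF s] yx(1)
  have A: "A \<in> obj C" using d unfolding A_def by simp
  \<comment> \<open>Since q p = 0, the map n is killed by q on the left and by p on the right. So n
    n = 0, and 1 + n fixes both p and q, that is, the whole triangle on the composite.\<close>
  define n where "n = p \<cdot> (s \<cdot> q)"
  have n: "n \<in> arr C" "src C n = A" "tgt C n = A" using h by (simp_all add: n_def)
  have qp: "q \<cdot> p = zero_arr C (src C p) (tgt C q)" using exact_cmp_zero'(1)[OF T(3)] .
  have qn: "q \<cdot> n = zero_arr C A (tgt C q)"
    using h A cmp_eq_cmp[OF qp, of "s \<cdot> q"] by (simp add: n_def)
  have np: "n \<cdot> p = zero_arr C (src C p) A" using h A qp by (simp add: n_def)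
  have nn: "n \<cdot> n = zero_arr C A A"
    using h A qn by (simp add: n_def)
  define \<theta> where "\<theta> = ident C A \<oplus> n"
  have \<theta>: "\<theta> \<in> Hom C A A" using A n by (auto simp: \<theta>_def intro!: HomI)
  have \<theta>_iso: "is_iso C \<theta>" "(ident C A \<oplus> neg C n) \<cdot> \<theta> = ident C A"
    using is_iso_unipotent[of n A] n nn by (simp_all add: \<theta>_def Hom_def)
  have n\<alpha>: "p \<cdot> (s \<cdot> x'') = n \<cdot> \<alpha>" using h by (simp add: n_def eqs(2))
  have \<beta>n: "y' \<cdot> (s \<cdot> q) = \<beta> \<cdot> n" using h cmp_eq_cmp[OF eqs(3), of "s \<cdot> q"] by (simp add: n_def)
  \<comment> \<open>The new second map is \<beta> followed backwards along the inverse 1 - n of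
    \<theta>; hence (1, \<theta>, 1) is an isomorphism from the old triangle to the new one.\<close>
  have \<beta>1: "\<beta> \<oplus> neg C (\<beta> \<cdot> n) = \<beta> \<cdot> (ident C A \<oplus> neg C n)" using h n A by simp
  have x''x': "x'' \<cdot> x' = zero_arr C (src C x') (tgt C x'')" using exact_cmp_zero'(1)[OF T(1)] .
  have "(\<alpha> \<oplus> n \<cdot> \<alpha>, \<beta> \<oplus> neg C (\<beta> \<cdot> n), \<gamma>) \<in> exact C"
    by (rule exact_iso[OF T(4), where f = "ident C (src C \<alpha>)" and g = \<theta>
          and h = "ident C (tgt C \<beta>)" and X' = "src C \<alpha>" and Y' = A and Z' = "tgt C \<beta>"])
      (use h n A HomD[OF \<theta>] \<theta>_iso in
        \<open>auto simp: is_iso_ident \<theta>_def \<beta>1 simp del: cmp_add(1) intro!: HomI\<close>)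
  moreover have "(\<alpha> \<oplus> n \<cdot> \<alpha>) \<cdot> x' = p \<cdot> y"
    using h x''x' n\<alpha>[symmetric] by (simp add: eqs(1))
  moreover have "q \<cdot> (\<alpha> \<oplus> n \<cdot> \<alpha>) = x''"
    using h n A eqs(2) cmp_eq_cmp[OF qn, of \<alpha>] by simp
  moreover have "(\<beta> \<oplus> neg C (\<beta> \<cdot> n)) \<cdot> p = y'" using h n A np eqs(3) by simp
  moreover have "y'' \<cdot> (\<beta> \<oplus> neg C (\<beta> \<cdot> n)) = susp C x \<cdot> q"
    using h n A qn eqs(5) cmp_eq_cmp[OF eqs(5), of n] by simp
  moreover have "\<alpha> \<oplus> n \<cdot> \<alpha> \<in> Hom C (tgt C x') (tgt C p)"
    "\<beta> \<oplus> neg C (\<beta> \<cdot> n) \<in> Hom C (tgt C p) (tgt C y')"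
    using h n by (auto intro!: HomI)
  ultimately show ?thesis
    unfolding octahedron_def prod.case n\<alpha> \<beta>n
    using T(1-3) yx homs(3) eqs(4) by blast
qed

end


section \<open>Lifts, good maps and Verdier good maps\<close>

locale triangle_square = triangulated_category C
  for C :: "('o, 'm, 'e) triangulated_cat_scheme" (structure) +
  fixes X Y Z X' Y' Z' and u v w u' v' w' f g
  assumes u: "u \<in> Hom C X Y" and v: "v \<in> Hom C Y Z" and w: "w \<in> Hom C Z (susp_obj C X)"
    and u': "u' \<in> Hom C X' Y'" and v': "v' \<in> Hom C Y' Z'"
    and w': "w' \<in> Hom C Z' (susp_obj C X')"
    and f: "f \<in> Hom C X X'" and g: "g \<in> Hom C Y Y'"
    and square: "g \<cdot> u = u' \<cdot> f"
    and exact: "(u, v, w) \<in> exact C" and exact': "(u', v', w') \<in> exact C"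
begin

lemma objs [simp]: "X \<in> obj C" "Y \<in> obj C" "Z \<in> obj C" "X' \<in> obj C" "Y' \<in> obj C" "Z' \<in> obj C"
  using Hom_obj[OF u] Hom_obj[OF v] Hom_obj[OF u'] Hom_obj[OF v'] by auto

lemma arrs [simp]:
  "u \<in> arr C" "src C u = X" "tgt C u = Y" "v \<in> arr C" "src C v = Y" "tgt C v = Z"
  "w \<in> arr C" "src C w = Z" "tgt C w = susp_obj C X"
  "u' \<in> arr C" "src C u' = X'" "tgt C u' = Y'" "v' \<in> arr C" "src C v' = Y'" "tgt C v' = Z'"
  "w' \<in> arr C" "src C w' = Z'" "tgt C w' = susp_obj C X'"
  "f \<in> arr C" "src C f = X" "tgt C f = X'" "g \<in> arr C" "src C g = Y" "tgt C g = Y'"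
  using u v w u' v' w' f g by (auto simp: Hom_def)

section \<open>The mapping cone of (f, g, 0) and the good maps\<close>

definition cone1 where "cone1 b = matrix_map C u' b (zero_arr C X' Z) (neg C v)"

definition cone2 where
  "cone2 = matrix_map C v' (zero_arr C Z Z') (zero_arr C Y' (susp_obj C X)) (neg C w)"

definition cone3 where
  "cone3 b = susp_dsum C X' Y \<cdot>
    matrix_map C w' (susp C b) (zero_arr C Z' (susp_obj C Y)) (neg C (susp C u))"

text \<open>The entries b and c stay free so that (0, 0, 0) and (f, g, 0) are instances of one
  family.\<close>

lemma mapping_cone_eq:
  "mapping_cone C (u, v, w) (u', v', w') b c (zero_arr C Z Z') = (cone1 c, cone2, cone3 b)"
  by (simp add: mapping_cone_def Let_def cone1_def cone2_def cone3_def)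

lemma cone1:
  assumes "b \<in> Hom C Y Y'"
  shows "cone1 b \<in> Hom C (dsum C X' Y) (dsum C Y' Z)"
    "cone1 b \<cdot> in1 C X' Y = in1 C Y' Z \<cdot> u'"
    "cone1 b \<cdot> in2 C X' Y = in1 C Y' Z \<cdot> b \<oplus> neg C (in2 C Y' Z \<cdot> v)"
    "pr1 C Y' Z \<cdot> cone1 b = u' \<cdot> pr1 C X' Y \<oplus> b \<cdot> pr2 C X' Y"
  using matrix_map_simps[of u' X' Y' b Y "zero_arr C X' Z" Z "neg C v"] assms
  by (simp_all add: cone1_def Hom_def)

lemma cone2:
  "cone2 \<in> Hom C (dsum C Y' Z) (dsum C Z' (susp_obj C X))"
  "cone2 \<cdot> in1 C Y' Z = in1 C Z' (susp_obj C X) \<cdot> v'"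
  "cone2 \<cdot> in2 C Y' Z = neg C (in2 C Z' (susp_obj C X) \<cdot> w)"
  using matrix_map_simps[of v' Y' Z' "zero_arr C Z Z'" Z "zero_arr C Y' (susp_obj C X)"
      "susp_obj C X" "neg C w"]
  by (simp_all add: cone2_def Hom_def)

lemma cone3:
  assumes "b \<in> Hom C X X'"
  shows "cone3 b \<in> Hom C (dsum C Z' (susp_obj C X)) (susp_obj C (dsum C X' Y))"
    "cone3 b \<cdot> in1 C Z' (susp_obj C X) = susp C (in1 C X' Y) \<cdot> w'"
    "cone3 b \<cdot> in2 C Z' (susp_obj C X) =
      susp C (in1 C X' Y) \<cdot> susp C b \<oplus> neg C (susp C (in2 C X' Y) \<cdot> susp C u)"
proof -
  define M where "M = matrix_map C w' (susp C b) (zero_arr C Z' (susp_obj C Y)) (neg C (susp C u))"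
  have M: "M \<in> Hom C (dsum C Z' (susp_obj C X)) (dsum C (susp_obj C X') (susp_obj C Y))"
    "M \<cdot> in1 C Z' (susp_obj C X) = in1 C (susp_obj C X') (susp_obj C Y) \<cdot> w'"
    "M \<cdot> in2 C Z' (susp_obj C X) = in1 C (susp_obj C X') (susp_obj C Y) \<cdot> susp C b \<oplus>
      neg C (in2 C (susp_obj C X') (susp_obj C Y) \<cdot> susp C u)"
    using matrix_map_simps[of w' Z' "susp_obj C X'" "susp C b" "susp_obj C X"
        "zero_arr C Z' (susp_obj C Y)" "susp_obj C Y" "neg C (susp C u)"] assms
    by (simp_all add: M_def Hom_def)
  show "cone3 b \<in> Hom C (dsum C Z' (susp_obj C X)) (susp_obj C (dsum C X' Y))"
    "cone3 b \<cdot> in1 C Z' (susp_obj C X) = susp C (in1 C X' Y) \<cdot> w'"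
    "cone3 b \<cdot> in2 C Z' (susp_obj C X) =
      susp C (in1 C X' Y) \<cdot> susp C b \<oplus> neg C (susp C (in2 C X' Y) \<cdot> susp C u)"
    using HomD[OF M(1)] M(2,3) HomD[OF assms]
    by (auto simp: cone3_def M_def[symmetric] cmp_eq_cmp[OF susp_dsum_simps(4)]
        cmp_eq_cmp[OF susp_dsum_simps(5)] intro!: HomI)
qed

lemma zero_in_Hom: "zero_arr C X X' \<in> Hom C X X'" "zero_arr C Y Y' \<in> Hom C Y Y'"
  by (simp_all add: Hom_def)

text \<open>The summands are the primed triangle and the rotation of the other one with all three
  signs negative.\<close>

lemma exact_zero_cone: "(cone1 (zero_arr C Y Y'), cone2, cone3 (zero_arr C X X')) \<in> exact C"
  by (rule exact_dsum[OF exact' exact_rotate_neg[OF exact] u' v' _ _ cone1(1,2)[OF zero_in_Hom(2)]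
        _ cone2(1,2) _ cone3(1,2)[OF zero_in_Hom(1)]])
    (simp_all add: Hom_def cone1 cone2 cone3)

text \<open>Through the lift, v' g contains v' u' and (\<Sigma>f) w contains (\<Sigma>u) w; both
  vanish.\<close>

lemma fill_in_zero_if_lift:
  assumes k: "k \<in> Hom C Y X'" "k \<cdot> u = f" "u' \<cdot> k = g"
  shows "fill_in C (u, v, w) (u', v', w') f g (zero_arr C Z Z')"
proof -
  note hk = HomD[OF k(1)]
  have "v' \<cdot> g = zero_arr C Y Z'"
    using exact_cmp_zero[OF exact'] cmp_eq_cmp[of v' u' _ k] hk by (simp flip: k(3))
  moreover have "susp C f \<cdot> w = zero_arr C Z (susp_obj C X')"
    using exact_cmp_zero'(2)[OF exact] hk by (simp flip: k(2))
  ultimately show ?thesis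
    using exact exact' square
    by (simp add: fill_in_def triangle_map_def commuting_triple_def Hom_def)
qed

lemma good_if_lift:
  assumes k: "k \<in> Hom C Y X'" "k \<cdot> u = f" "u' \<cdot> k = g"
  shows "good C (u, v, w) (u', v', w') f g (zero_arr C Z Z')"
proof -
  note hk = HomD[OF k(1)]
  let ?E\<^sub>1 = "cone1 (zero_arr C Y Y')" and ?E\<^sub>3 = "cone3 (zero_arr C X X')"
  note E\<^sub>1 = cone1[OF zero_in_Hom(2)] and E\<^sub>3 = cone3[OF zero_in_Hom(1)]
  note D\<^sub>1 = cone1[OF g] and D\<^sub>3 = cone3[OF f]
  note ED = HomD[OF E\<^sub>1(1)] HomD[OF E\<^sub>3(1)] HomD[OF cone2(1)] HomD[OF D\<^sub>1(1)] HomD[OF D\<^sub>3(1)]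
  \<comment> \<open>The sign is dictated by the second column: composing \<open>cone1 g\<close> with
    1 + n turns its entry g into g - u' k = 0.\<close>
  define n where "n = neg C (in1 C X' Y \<cdot> (k \<cdot> pr2 C X' Y))"
  define \<phi> where "\<phi> = ident C (dsum C X' Y) \<oplus> n"
  have n: "n \<in> arr C" "src C n = dsum C X' Y" "tgt C n = dsum C X' Y"
    "n \<cdot> in1 C X' Y = zero_arr C X' (dsum C X' Y)" "n \<cdot> in2 C X' Y = neg C (in1 C X' Y \<cdot> k)"
    using hk by (simp_all add: n_def)
  have \<phi>: "\<phi> \<in> arr C" "src C \<phi> = dsum C X' Y" "tgt C \<phi> = dsum C X' Y"
    "\<phi> \<cdot> in1 C X' Y = in1 C X' Y" "\<phi> \<cdot> in2 C X' Y = in2 C X' Y \<oplus> neg C (in1 C X' Y \<cdot> k)"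
    using n by (simp_all add: \<phi>_def)
  have \<phi>_iso: "is_iso C \<phi>"
    unfolding \<phi>_def
    by (rule is_iso_unipotent) (use hk in \<open>auto simp: n_def intro!: HomI\<close>)
  have 1: "?E\<^sub>1 = cone1 g \<cdot> \<phi>"
    by (rule eq_from_dsumI[of _ X' Y "dsum C Y' Z"])
      (use ED \<phi> hk in \<open>simp_all add: Hom_def E\<^sub>1(2,3) D\<^sub>1(2,3) cmp_eq_cmp[OF D\<^sub>1(2)] k(3) add_assoc
        add_commute[of "in1 C Y' Z \<cdot> g"]\<close>)
  have susp_\<phi>: "susp C \<phi> \<cdot> susp C (in1 C X' Y) = susp C (in1 C X' Y)"
    "susp C \<phi> \<cdot> susp C (in2 C X' Y) =
      susp C (in2 C X' Y) \<oplus> neg C (susp C (in1 C X' Y) \<cdot> susp C k)"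
    using \<phi> hk by (simp_all flip: susp_cmp)
  have susp_f: "susp C f = susp C k \<cdot> susp C u" using hk by (simp flip: k(2))
  have 3: "susp C \<phi> \<cdot> ?E\<^sub>3 = cone3 f"
    by (rule eq_from_dsumI[of _ Z' "susp_obj C X" "susp_obj C (dsum C X' Y)"])
      (use ED \<phi> hk in \<open>simp_all add: Hom_def E\<^sub>3(2,3) D\<^sub>3(2,3) cmp_eq_cmp[OF susp_\<phi>(1)]
        cmp_eq_cmp[OF susp_\<phi>(2)] susp_f add_commute\<close>)
  have "(cone1 g, cone2, cone3 f) \<in> exact C"
    by (rule exact_iso[OF exact_zero_cone D\<^sub>1(1) cone2(1) D\<^sub>3(1), where f = \<phi>
          and g = "ident C (dsum C Y' Z)" and h = "ident C (dsum C Z' (susp_obj C X))"])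
      (use ED \<phi> \<phi>_iso in \<open>auto simp: is_iso_ident 1 3 intro!: HomI\<close>)
  then show ?thesis
    using fill_in_zero_if_lift[OF k] by (simp add: good_def fill_in_def mapping_cone_eq)
qed

lemma lift_if_good:
  assumes "good C (u, v, w) (u', v', w') f g (zero_arr C Z Z')"
  shows "\<exists>k \<in> Hom C Y X'. k \<cdot> u = f \<and> u' \<cdot> k = g"
proof -
  let ?E\<^sub>1 = "cone1 (zero_arr C Y Y')" and ?E\<^sub>3 = "cone3 (zero_arr C X X')"
  note E\<^sub>1 = cone1[OF zero_in_Hom(2)] and E\<^sub>3 = cone3[OF zero_in_Hom(1)]
  note D\<^sub>1 = cone1[OF g] and D\<^sub>3 = cone3[OF f]
  note ED = HomD[OF E\<^sub>1(1)] HomD[OF E\<^sub>3(1)] HomD[OF cone2(1)] HomD[OF D\<^sub>1(1)] HomD[OF D\<^sub>3(1)]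
  have DX: "(cone1 g, cone2, cone3 f) \<in> exact C" using assms by (simp add: good_def mapping_cone_eq)
  define I where "I = dsum C X' Y"
  have I: "I \<in> obj C" by (simp add: I_def)
  \<comment> \<open>After rotation the shared middle map comes first, so identities on its two ends
    admit a fill-in H, here from the cone of (f, g, 0) to the cone of zero.\<close>
  have "ident C (dsum C Z' (susp_obj C X)) \<cdot> cone2 = cone2 \<cdot> ident C (dsum C Y' Z)"
    using ED by simp
  then obtain H where H: "H \<in> Hom C (susp_obj C I) (susp_obj C I)"
    "H \<cdot> cone3 f = ?E\<^sub>3 \<cdot> ident C (dsum C Z' (susp_obj C X))"
    "susp C (ident C (dsum C Y' Z)) \<cdot> neg C (susp C (cone1 g)) = neg C (susp C ?E\<^sub>1) \<cdot> H"
    using exact_fill_Hom[OF rotate[OF DX] rotate[OF exact_zero_cone] cone2(1) D\<^sub>3(1)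
        cone2(1) E\<^sub>3(1) ident_in_Hom ident_in_Hom]
    by (auto simp: I_def)
  obtain \<phi> where \<phi>: "\<phi> \<in> Hom C I I" "susp C \<phi> = H" using susp_full[OF H(1) I I] .
  note h\<phi> = HomD[OF \<phi>(1)] I
  have 3: "susp C \<phi> \<cdot> cone3 f = ?E\<^sub>3" using ED H(2) \<phi>(2) by simp
  have "neg C (neg C (susp C (cone1 g))) = neg C (neg C (susp C (?E\<^sub>1 \<cdot> \<phi>)))"
    using ED H(3) h\<phi> unfolding \<phi>(2)[symmetric] by (simp add: I_def)
  then have "susp C (cone1 g) = susp C (?E\<^sub>1 \<cdot> \<phi>)" using ED h\<phi> by (simp add: I_def del: susp_cmp)
  then have 1: "cone1 g = ?E\<^sub>1 \<cdot> \<phi>"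
    using susp_faithful[of "cone1 g" I "dsum C Y' Z" "?E\<^sub>1 \<cdot> \<phi>"] ED h\<phi>
    by (simp add: I_def Hom_def del: susp_cmp)
  \<comment> \<open>The pair a, b is the top row of \<phi>. Reading fact \<open>1\<close> in its
    first row gives u' a = u' and u' b = g.\<close>
  define a where "a = pr1 C X' Y \<cdot> (\<phi> \<cdot> in1 C X' Y)"
  define b where "b = pr1 C X' Y \<cdot> (\<phi> \<cdot> in2 C X' Y)"
  have ab: "a \<in> arr C" "src C a = X'" "tgt C a = X'" "b \<in> arr C" "src C b = Y" "tgt C b = X'"
    using h\<phi> by (simp_all add: a_def b_def I_def)
  have pr_E\<^sub>1: "pr1 C Y' Z \<cdot> ?E\<^sub>1 = u' \<cdot> pr1 C X' Y"
    using E\<^sub>1(4) by simp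
  have u'_pr: "u' \<cdot> (pr1 C X' Y \<cdot> (\<phi> \<cdot> x)) = pr1 C Y' Z \<cdot> (cone1 g \<cdot> x)"
    if "x \<in> arr C" "tgt C x = I" for x
    using that h\<phi> ED cmp_eq_cmp[OF pr_E\<^sub>1, of "\<phi> \<cdot> x"] by (simp add: I_def 1)
  have ua: "u' \<cdot> a = u'" using ED by (simp add: a_def u'_pr I_def D\<^sub>1(2))
  have ub: "u' \<cdot> b = g" using ED by (simp add: b_def u'_pr I_def D\<^sub>1(3))
  have susp_ab: "susp C a = susp C (pr1 C X' Y) \<cdot> (susp C \<phi> \<cdot> susp C (in1 C X' Y))"
    "susp C b = susp C (pr1 C X' Y) \<cdot> (susp C \<phi> \<cdot> susp C (in2 C X' Y))"
    using h\<phi> by (simp_all add: a_def b_def I_def)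
  have pr_in: "susp C (pr1 C X' Y) \<cdot> (susp C (in1 C X' Y) \<cdot> x) = x"
    "susp C (pr1 C X' Y) \<cdot> (susp C (in2 C X' Y) \<cdot> y) = zero_arr C (src C y) (susp_obj C X')"
    if "x \<in> arr C" "tgt C x = susp_obj C X'" "y \<in> arr C" "tgt C y = susp_obj C Y" for x y
    using that by (simp_all flip: cmp_assoc' susp_cmp)
  \<comment> \<open>The top row of fact \<open>3\<close>: its first column gives (\<Sigma>a) w' =
    w', its second gives a f = b u because the corresponding entry of the zero cone
    vanishes.\<close>
  have "susp C (pr1 C X' Y) \<cdot> (susp C \<phi> \<cdot> (cone3 f \<cdot> in1 C Z' (susp_obj C X))) =
      susp C (pr1 C X' Y) \<cdot> (?E\<^sub>3 \<cdot> in1 C Z' (susp_obj C X))"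
    using ED h\<phi> cmp_eq_cmp[OF 3, of "in1 C Z' (susp_obj C X)"] by (simp add: I_def)
  then have aw: "susp C a \<cdot> w' = w'"
    using h\<phi> pr_in[of w' "susp C u"] unfolding D\<^sub>3(2) E\<^sub>3(2) by (simp add: susp_ab I_def)
  have "susp C (pr1 C X' Y) \<cdot> (susp C \<phi> \<cdot> (cone3 f \<cdot> in2 C Z' (susp_obj C X))) =
      susp C (pr1 C X' Y) \<cdot> (?E\<^sub>3 \<cdot> in2 C Z' (susp_obj C X))"
    using ED h\<phi> cmp_eq_cmp[OF 3, of "in2 C Z' (susp_obj C X)"] by (simp add: I_def)
  then have "susp C (a \<cdot> f) \<oplus> neg C (susp C (b \<cdot> u)) = zero_arr C (susp_obj C X) (susp_obj C X')"
    using h\<phi> ab pr_in[of w' "susp C u"] unfolding D\<^sub>3(3) E\<^sub>3(3) by (simp add: susp_ab I_def)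
  then have "susp C (a \<cdot> f) = susp C (b \<cdot> u)"
    using eq_if_diff_zero[of "susp C (a \<cdot> f)" "susp C (b \<cdot> u)"] ab by (simp del: susp_cmp)
  then have af: "a \<cdot> f = b \<cdot> u"
    using susp_faithful[of "a \<cdot> f" X X' "b \<cdot> u"] ab by (simp add: Hom_def del: susp_cmp)
  define n where "n = a \<oplus> neg C (ident C X')"
  have n: "n \<in> arr C" "src C n = X'" "tgt C n = X'" using ab by (simp_all add: n_def)
  have un: "u' \<cdot> n = zero_arr C X' Y'" using ab ua by (simp add: n_def)
  \<comment> \<open>This makes \<Sigma>n factor through \<Sigma>u' in the twice rotated triangle;
    then u' n = 0 forces n n = 0.\<close>
  have "susp C n \<cdot> w' = zero_arr C Z' (susp_obj C X')" using ab aw by (simp add: n_def)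
  then obtain s where s: "s \<in> Hom C (susp_obj C Y') (susp_obj C X')"
    "susp C n = s \<cdot> neg C (susp C u')"
    using weak_cokernel[OF rotate[OF rotate[OF exact']], of "susp C n" "susp_obj C X'"] n
    by (auto simp: Hom_def)
  have "susp C (n \<cdot> n) = s \<cdot> neg C (susp C (u' \<cdot> n))"
    using n s(2) HomD[OF s(1)] by simp
  then have "susp C (n \<cdot> n) = susp C (zero_arr C X' X')"
    unfolding un using HomD[OF s(1)] by simp
  then have nn: "n \<cdot> n = zero_arr C X' X'"
    using susp_faithful[of "n \<cdot> n" X' X' "zero_arr C X' X'"] n by (simp add: Hom_def del: susp_cmp)
  have a: "a = ident C X' \<oplus> n" using ab by (simp add: n_def)
  \<comment> \<open>The lift is (1 - n) b: on u it gives (1 - n) a f = f, and u' does not see the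
    correction because u' n = 0.\<close>
  have "(ident C X' \<oplus> neg C n) \<cdot> a = ident C X'"
    unfolding a by (rule is_iso_unipotent(2)) (use n nn in \<open>auto intro!: HomI\<close>)
  then have "(ident C X' \<oplus> neg C n) \<cdot> (b \<cdot> u) = f"
    using ab n cmp_eq_cmp[of "ident C X' \<oplus> neg C n" a "ident C X'" f] unfolding af[symmetric]
    by simp
  then have "((ident C X' \<oplus> neg C n) \<cdot> b) \<cdot> u = f" using ab n by simp
  moreover have "u' \<cdot> ((ident C X' \<oplus> neg C n) \<cdot> b) = g"
    using ab n cmp_eq_cmp[OF un, of b] by (simp add: ub)
  moreover have "(ident C X' \<oplus> neg C n) \<cdot> b \<in> Hom C Y X'" using ab n by (auto intro!: HomI)
  ultimately show ?thesis by blast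
qed

section \<open>The rotated triangles and Verdier good maps\<close>

definition a where "a = neg C (counit C X \<cdot> desusp C w)"

definition a' where "a' = neg C (counit C X' \<cdot> desusp C w')"

definition t where "t = unit C Z \<cdot> v"

definition t' where "t' = unit C Z' \<cdot> v'"

lemma rotated_arrs [simp]:
  "a \<in> arr C" "src C a = desusp_obj C Z" "tgt C a = X"
  "a' \<in> arr C" "src C a' = desusp_obj C Z'" "tgt C a' = X'"
  "t \<in> arr C" "src C t = Y" "tgt C t = susp_obj C (desusp_obj C Z)"
  "t' \<in> arr C" "src C t' = Y'" "tgt C t' = susp_obj C (desusp_obj C Z')"
  by (simp_all add: a_def a'_def t_def t'_def)

lemma rotate_back_eq:
  "rotate_back C (u, v, w) = (a, u, t)" "rotate_back C (u', v', w') = (a', u', t')"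
  by (simp_all add: rotate_back_def a_def a'_def t_def t'_def)

lemma exact_rotated: "(a, u, t) \<in> exact C" "(a', u', t') \<in> exact C"
  using exact_rotate_back[OF exact] exact_rotate_back[OF exact'] by (simp_all add: rotate_back_eq)

lemma rotated_cmp_zero:
  "u \<cdot> a = zero_arr C (desusp_obj C Z) Y" "u' \<cdot> a' = zero_arr C (desusp_obj C Z') Y'"
  "t \<cdot> u = zero_arr C X (susp_obj C (desusp_obj C Z))"
  "t' \<cdot> u' = zero_arr C X' (susp_obj C (desusp_obj C Z'))"
  using exact_rotated[THEN exact_cmp_zero] exact_rotated[THEN exact_cmp_zero'(1)] by simp_all

text \<open>A retraction \<rho> of p exists because the first map is zero, and \<beta> lifts through
  u' because t' \<beta> = 0, but such a lift r need not retract p. The defect n = 1 - r p is killed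
  by u', so adding n \<rho> to r repairs the retraction without changing u' r.\<close>

lemma compatible_retraction:
  assumes T: "(zero_arr C S X', p, q) \<in> exact C" and S: "S \<in> obj C" and p: "p \<in> Hom C X' A"
    and \<beta>: "\<beta> \<in> Hom C A Y'" "\<beta> \<cdot> p = u'"
      "t' \<cdot> \<beta> = zero_arr C A (susp_obj C (desusp_obj C Z'))"
  obtains r where "r \<in> Hom C A X'" "r \<cdot> p = ident C X'" "u' \<cdot> r = \<beta>"
proof -
  note h = S HomD[OF p] HomD[OF \<beta>(1)] Hom_obj[OF p]
  obtain \<rho> where \<rho>: "\<rho> \<in> Hom C A X'" "ident C X' = \<rho> \<cdot> p"
    using weak_cokernel[OF T, of "ident C X'" X'] h by (auto simp: Hom_def)
  obtain r where r: "r \<in> Hom C A X'" "\<beta> = u' \<cdot> r"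
    using weak_kernel[OF rotate[OF exact_rotated(2)], of \<beta> A] \<beta> by auto
  note h = h HomD[OF \<rho>(1)] HomD[OF r(1)]
  define n where "n = ident C X' \<oplus> neg C (r \<cdot> p)"
  have n: "n \<in> arr C" "src C n = X'" "tgt C n = X'" using h by (simp_all add: n_def)
  have "u' \<cdot> (r \<cdot> p) = u'" using h r(2) \<beta>(2) by simp
  then have un: "u' \<cdot> n = zero_arr C X' Y'" using h by (simp add: n_def)
  show ?thesis
  proof (rule that)
    show "r \<oplus> n \<cdot> \<rho> \<in> Hom C A X'" using h n by (auto intro!: HomI)
    show "(r \<oplus> n \<cdot> \<rho>) \<cdot> p = ident C X'" using h n \<rho>(2)[symmetric] by (simp add: n_def)
    show "u' \<cdot> (r \<oplus> n \<cdot> \<rho>) = \<beta>"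
      using h n cmp_eq_cmp[OF un, of \<rho>] by (simp add: r(2))
  qed
qed

lemma lift_if_verdier_good:
  assumes "verdier_good C (a, u, t) (a', u', t')
    (zero_arr C (desusp_obj C Z) (desusp_obj C Z')) f g"
  shows "\<exists>k \<in> Hom C Y X'. k \<cdot> u = f \<and> u' \<cdot> k = g"
proof -
  let ?S = "desusp_obj C Z"
  obtain f' f'' g' g'' p q \<alpha>\<^sub>1 \<beta>\<^sub>1 \<gamma>\<^sub>1 \<alpha>\<^sub>2 \<beta>\<^sub>2 \<gamma>\<^sub>2 where
    o1: "octahedron C (a, u, t) (f, g', g'') (f \<cdot> a, p, q) \<alpha>\<^sub>1 \<beta>\<^sub>1 \<gamma>\<^sub>1"
    and o2: "octahedron C (zero_arr C ?S (desusp_obj C Z'), f', f'') (a', u', t') (f \<cdot> a, p, q)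
      \<alpha>\<^sub>2 \<beta>\<^sub>2 \<gamma>\<^sub>2"
    and g: "g = \<beta>\<^sub>2 \<cdot> \<alpha>\<^sub>1"
    using assms by (auto simp: verdier_good_def)
  \<comment> \<open>The second octahedron belongs to the composite of 0 with a', and it shares its
    triangle with f a.\<close>
  have fa: "f \<cdot> a = zero_arr C ?S X'" using o2 by (simp add: octahedron_def)
  have T: "(zero_arr C ?S X', p, q) \<in> exact C" using o2 fa by (simp add: octahedron_def)
  define A where "A = tgt C p"
  have pq: "p \<in> arr C" "src C p = X'" "tgt C p = A" "q \<in> arr C" "src C q = A"
    "tgt C q = susp_obj C ?S" "A \<in> obj C"
    using exactD[OF T] by (auto simp: A_def)
  have o1': "\<alpha>\<^sub>1 \<in> Hom C Y A" "\<alpha>\<^sub>1 \<cdot> u = p \<cdot> f"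
    using o1 pq by (simp_all add: octahedron_def)
  \<comment> \<open>The vanishing of \<open>t' \<cdot> \<beta>\<^sub>2\<close> is the last
    octahedral relation, whose right-hand side contains the suspension of the zero map.\<close>
  have o2': "\<beta>\<^sub>2 \<in> Hom C A Y'" "\<beta>\<^sub>2 \<cdot> p = u'"
    "t' \<cdot> \<beta>\<^sub>2 = zero_arr C A (susp_obj C (desusp_obj C Z'))"
    using o2 pq by (simp_all add: octahedron_def)
  obtain r where r: "r \<in> Hom C A X'" "r \<cdot> p = ident C X'" "u' \<cdot> r = \<beta>\<^sub>2"
    using compatible_retraction[OF T _ _ o2'] pq by (auto simp: Hom_def)
  note h = pq HomD[OF r(1)] HomD[OF o1'(1)]
  show ?thesis
  proof (intro bexI conjI)
    show "(r \<cdot> \<alpha>\<^sub>1) \<cdot> u = f" using h o1'(2) cmp_eq_cmp[OF r(2), of f] by simp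
    show "u' \<cdot> (r \<cdot> \<alpha>\<^sub>1) = g" using h cmp_eq_cmp[OF r(3), of \<alpha>\<^sub>1] by (simp add: g)
    show "r \<cdot> \<alpha>\<^sub>1 \<in> Hom C Y X'" using h by (auto intro!: HomI)
  qed
qed

lemma verdier_good_if_lift:
  assumes k: "k \<in> Hom C Y X'" "k \<cdot> u = f" "u' \<cdot> k = g"
  shows "verdier_good C (a, u, t) (a', u', t')
    (zero_arr C (desusp_obj C Z) (desusp_obj C Z')) f g"
proof -
  note hk = HomD[OF k(1)]
  define S S' where S: "S = desusp_obj C Z" and S': "S' = desusp_obj C Z'"
  have SS [simp]: "S \<in> obj C" "S' \<in> obj C" by (simp_all add: S S')
  have fa: "f \<cdot> a = zero_arr C S X'" using hk rotated_cmp_zero(1) by (simp add: S flip: k(2))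
  have t'g: "t' \<cdot> g = zero_arr C Y (susp_obj C S')"
    using hk cmp_eq_cmp[OF rotated_cmp_zero(4), of k] by (simp add: S' flip: k(3))
  obtain f' f'' where F: "(zero_arr C S S', f', f'') \<in> exact C"
    using exact_extend[of "zero_arr C S S'"] by auto
  obtain g' g'' where G: "(f, g', g'') \<in> exact C"
    using exact_extend[of f] by auto
  obtain p q where T: "(zero_arr C S X', p, q) \<in> exact C"
    using exact_extend[of "zero_arr C S X'"] by auto
  define A where "A = tgt C p"
  have pq: "p \<in> arr C" "src C p = X'" "tgt C p = A" "q \<in> arr C" "src C q = A"
    "tgt C q = susp_obj C S" "A \<in> obj C"
    using exactD[OF T] by (auto simp: A_def)
  obtain \<alpha>\<^sub>1 \<beta>\<^sub>1 \<gamma>\<^sub>1 where o1: "octahedron C (a, u, t) (f, g', g'') (f \<cdot> a, p, q) \<alpha>\<^sub>1 \<beta>\<^sub>1 \<gamma>\<^sub>1"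
    using octahedral[OF exact_rotated(1) G, of p q] T by (auto simp: fa)
  \<comment> \<open>Both composites are the zero arrow, so one triangle (0, p, q) serves both
    octahedra.\<close>
  have z: "a' \<cdot> zero_arr C S S' = f \<cdot> a" by (simp add: fa S')
  obtain \<alpha>\<^sub>2 \<beta>\<^sub>2 \<gamma>\<^sub>2 where
    o2: "octahedron C (zero_arr C S S', f', f'') (a', u', t') (f \<cdot> a, p, q) \<alpha>\<^sub>2 \<beta>\<^sub>2 \<gamma>\<^sub>2"
    using octahedral[OF F exact_rotated(2), of p q] T unfolding z by (auto simp: fa S')
  have o1': "\<alpha>\<^sub>1 \<in> Hom C Y A" "\<alpha>\<^sub>1 \<cdot> u = p \<cdot> f" "q \<cdot> \<alpha>\<^sub>1 = t"
    using o1 pq by (simp_all add: octahedron_def)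
  have o2': "\<beta>\<^sub>2 \<in> Hom C A Y'" "\<beta>\<^sub>2 \<cdot> p = u'"
    "t' \<cdot> \<beta>\<^sub>2 = zero_arr C A (susp_obj C (desusp_obj C Z'))"
    using o2 pq by (simp_all add: octahedron_def S')
  obtain r where r: "r \<in> Hom C A X'" "r \<cdot> p = ident C X'" "u' \<cdot> r = \<beta>\<^sub>2"
    using compatible_retraction[OF T _ _ o2'] pq by (auto simp: Hom_def)
  note h = hk pq HomD[OF o1'(1)] HomD[OF o2'(1)] HomD[OF r(1)]
  \<comment> \<open>Both k and \<open>r \<cdot> \<alpha>\<^sub>1\<close> restrict to f along u, so
    their difference factors as s t. This s is the parameter of the conjugation.\<close>
  define e where "e = k \<oplus> neg C (r \<cdot> \<alpha>\<^sub>1)"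
  have e: "e \<in> Hom C Y X'" using h by (auto simp: e_def intro!: HomI)
  have "e \<cdot> u = zero_arr C X X'"
    using h cmp_eq_cmp[OF r(2), of f] by (simp add: e_def o1'(2) k(2))
  then obtain s where s: "s \<in> Hom C (susp_obj C S) X'" "e = s \<cdot> t"
    using weak_cokernel[OF rotate[OF exact_rotated(1)], of e X'] e by (auto simp: Hom_def S)
  note h = h HomD[OF s(1)]
  have o3: "octahedron C (a, u, t) (f, g', g'') (f \<cdot> a, p, q) (\<alpha>\<^sub>1 \<oplus> p \<cdot> s \<cdot> t)
      (\<beta>\<^sub>1 \<oplus> neg C (g' \<cdot> s \<cdot> q)) \<gamma>\<^sub>1"
    by (rule octahedron_conjugate[OF o1]) (use s pq in simp)
  \<comment> \<open>Since r p = 1, the conjugated first map is sent by r to k exactly; applying u'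
    yields g. The second octahedron is left as it was.\<close>
  have "r \<cdot> (\<alpha>\<^sub>1 \<oplus> p \<cdot> e) = r \<cdot> \<alpha>\<^sub>1 \<oplus> e"
    using h HomD[OF e] cmp_eq_cmp[OF r(2), of e] by simp
  also have "\<dots> = k" using h by (simp add: e_def)
  finally have "\<beta>\<^sub>2 \<cdot> (\<alpha>\<^sub>1 \<oplus> p \<cdot> s \<cdot> t) = g"
    using h HomD[OF e] cmp_eq_cmp[OF r(3), of "\<alpha>\<^sub>1 \<oplus> p \<cdot> e"] by (simp add: k(3) s(2))
  moreover have "triangle_map C (a, u, t) (a', u', t') (zero_arr C S S') f g"
    using exact_rotated square fa t'g
    by (simp add: triangle_map_def commuting_triple_def Hom_def S S')
  moreover have "(f \<cdot> a, p, q) \<in> exact C" using T fa by simp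
  ultimately show ?thesis
    unfolding verdier_good_def using F G o2 o3 unfolding S S' by (simp add: prod.case) metis
qed

end

theorem corollary7p7:
  fixes C :: "('o, 'm, 'e) triangulated_cat_scheme" (structure)
  assumes "triangulated_category C"
    and "u \<in> Hom C X Y" and "u' \<in> Hom C X' Y'"
    and "f \<in> Hom C X X'" and "g \<in> Hom C Y Y'"
    and "g \<cdot> u = u' \<cdot> f"
    and "v \<in> Hom C Y Z" and "w \<in> Hom C Z (susp_obj C X)"
    and "v' \<in> Hom C Y' Z'" and "w' \<in> Hom C Z' (susp_obj C X')"
    and "(u, v, w) \<in> exact C" and "(u', v', w') \<in> exact C"
  shows "((\<exists>k \<in> Hom C Y X'. k \<cdot> u = f \<and> u' \<cdot> k = g) \<longleftrightarrow>
          fill_in C (u, v, w) (u', v', w') f g (zero_arr C Z Z') \<and>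
          good C (u, v, w) (u', v', w') f g (zero_arr C Z Z'))
       \<and> ((\<exists>k \<in> Hom C Y X'. k \<cdot> u = f \<and> u' \<cdot> k = g) \<longleftrightarrow>
          fill_in C (u, v, w) (u', v', w') f g (zero_arr C Z Z') \<and>
          verdier_good C (rotate_back C (u, v, w)) (rotate_back C (u', v', w'))
            (zero_arr C (desusp_obj C Z) (desusp_obj C Z')) f g)"
proof -
  interpret triangle_square C X Y Z X' Y' Z' u v w u' v' w' f g
    using assms by (simp add: triangle_square_def triangle_square_axioms_def)
  show ?thesis
    unfolding rotate_back_eq
    using fill_in_zero_if_lift good_if_lift lift_if_good verdier_good_if_lift lift_if_verdier_good
    by blast
qed

end
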